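(* Suppose that $p\ge5$ is a prime. Then, for every integer $r$, $$\sharp\{1\le n\le X\mid H(-n)\equiv r\!\!\pmod p\}\gg_{r,p}\begin{cases}\frac{\sqrt X}{\log X}&\text{if } r\not\equiv0\pmod p,\\ X&\text{if } r\equiv0\pmod p.\end{cases}$$
   Context: For a positive integer $n$, $H(-n)$ denotes the Hurwitz class number: the number of $SL_2(\mathbb{Z})$-equivalence classes $C$ of positive definite integral binary quadratic forms (not necessarily primitive) of discriminant $-n$, where each class $C$ is counted with multiplicity $\frac{1}{\mathrm{Aut}(C)}$; here $\mathrm{Aut}(C)$ is the order of the stabilizer of a form in $C$ in $PSL_2(\mathbb{Z})$, so that for instance $H(-3)=\frac13$ and $H(-4)=\frac12$. If there are no forms of discriminant $-n$ (i.e. $n\equiv1,2\pmod4$), then $H(-n)=0$. The values $H(-n)$ are rational numbers with denominator dividing $6$, hence $p$-integral for $p\ge5$, and congruences modulo $p$ are understood in the ring of $p$-integral rational numbers. The notation $\gg_{r,p}$ means: bounded below, for all sufficiently large $X$, by a positive constant (which may depend on $r$ and $p$) times the right-hand side. *)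

theory Defs
  imports
    "HOL-Analysis.Determinants"
    "HOL-Computational_Algebra.Primes"
    "HOL-Number_Theory.Cong"
    "HOL-Library.Landau_Symbols"
begin

text \<open>The triple \<open>(a, b, c)\<close> stands for the integral binary quadratic form
  \<open>a x\<^sup>2 + b x y + c y\<^sup>2\<close>.\<close>

type_synonym bqf = "int \<times> int \<times> int"

definition bqf_eval :: "bqf \<Rightarrow> int \<Rightarrow> int \<Rightarrow> int" where
  "bqf_eval = (\<lambda>(a, b, c) x y. a * x\<^sup>2 + b * x * y + c * y\<^sup>2)"

definition bqf_disc :: "bqf \<Rightarrow> int" where
  "bqf_disc = (\<lambda>(a, b, c). b\<^sup>2 - 4 * a * c)"

definition pos_def :: "bqf \<Rightarrow> bool" where
  "pos_def f \<longleftrightarrow> (\<forall>x y. (x, y) \<noteq> (0, 0) \<longrightarrow> bqf_eval f x y > 0)"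

definition pos_def_forms :: "int \<Rightarrow> bqf set" where
  "pos_def_forms D = {f. pos_def f \<and> bqf_disc f = D}"

definition SL2Z :: "(int ^ 2 ^ 2) set" where
  "SL2Z = {A. det A = 1}"

definition PSL2Z :: "(int ^ 2 ^ 2) set set" where
  "PSL2Z = SL2Z // {(A, B). A \<in> SL2Z \<and> B \<in> SL2Z \<and> (B = A \<or> B = - A)}"

text \<open>The right action \<open>(f \<cdot> A)(v) = f(A v)\<close> by linear substitution of variables;
  see \<open>bqf_eval_bqf_act\<close>.\<close>

definition bqf_act :: "bqf \<Rightarrow> int ^ 2 ^ 2 \<Rightarrow> bqf" where
  "bqf_act = (\<lambda>(a, b, c) A.
     (a * (A$1$1)\<^sup>2 + b * A$1$1 * A$2$1 + c * (A$2$1)\<^sup>2,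
      2 * a * A$1$1 * A$1$2 + b * (A$1$1 * A$2$2 + A$1$2 * A$2$1) + 2 * c * A$2$1 * A$2$2,
      a * (A$1$2)\<^sup>2 + b * A$1$2 * A$2$2 + c * (A$2$2)\<^sup>2))"

lemma bqf_eval_bqf_act:
  "bqf_eval (bqf_act f A) x y = bqf_eval f (A$1$1 * x + A$1$2 * y) (A$2$1 * x + A$2$2 * y)"
  by (cases f) (simp add: bqf_eval_def bqf_act_def power2_eq_square algebra_simps)

lemma bqf_act_mult: "bqf_act (bqf_act f A) B = bqf_act f (A ** B)"
  by (cases f)
     (simp add: bqf_act_def matrix_matrix_mult_def sum_2 power2_eq_square algebra_simps)

lemma bqf_act_uminus: "bqf_act f (- A) = bqf_act f A"
  by (cases f) (simp add: bqf_act_def)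

definition bqf_equiv :: "int \<Rightarrow> (bqf \<times> bqf) set" where
  "bqf_equiv D = {(f, g). f \<in> pos_def_forms D \<and> g \<in> pos_def_forms D \<and>
                          (\<exists>A\<in>SL2Z. g = bqf_act f A)}"

definition PSL2Z_stabilizer :: "bqf \<Rightarrow> (int ^ 2 ^ 2) set set" where
  "PSL2Z_stabilizer f = {P \<in> PSL2Z. \<forall>A\<in>P. bqf_act f A = f}"

text \<open>Equivalent forms have conjugate stabilizers, so the choice of representative
  is immaterial.\<close>

definition Aut_order :: "bqf set \<Rightarrow> nat" where
  "Aut_order C = card (PSL2Z_stabilizer (SOME f. f \<in> C))"

text \<open>The argument is the discriminant, so it is negative in all cases of interest.\<close>

definition hurwitz_class_number :: "int \<Rightarrow> rat" where
  "hurwitz_class_number D = (\<Sum>C\<in>pos_def_forms D // bqf_equiv D. 1 / of_nat (Aut_order C))"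

definition p_integral :: "nat \<Rightarrow> rat \<Rightarrow> bool" where
  "p_integral p x \<longleftrightarrow> \<not> int p dvd snd (quotient_of x)"

text \<open>Congruence modulo the ideal generated by \<open>p\<close> in the ring of \<open>p\<close>-integral rationals.\<close>

definition p_integral_cong :: "nat \<Rightarrow> rat \<Rightarrow> rat \<Rightarrow> bool" where
  "p_integral_cong p x y \<longleftrightarrow> p_integral p x \<and> p_integral p y \<and>
     (\<exists>z. p_integral p z \<and> x - y = of_nat p * z)"

end

(*
  For r divisible by p already the n congruent to 1 mod 4 suffice, since no form has
  discriminant -n and hence H(-n) = 0.

  For other r take n = 8 f^2 with f odd and -2 a square mod f, so that every prime divisor of f
  splits in Z[sqrt(-2)].  Then H(-8 f^2) = f.  Indeed a form of discriminant -8 f^2 is a multiple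
  c of the norm form x^2 + 2 y^2 restricted to a lattice of index D in Z[sqrt(-2)], with c D = f,
  because Z[sqrt(-2)] has class number one.  Choosing D minimal, the lattice projects onto both
  factors of Z[sqrt(-2)] / D = Z/D x Z/D, so it is the graph of a unit t mod D.  The pair (D, t)
  is a complete invariant of the class, automorphs are trivial, and the number of pairs is the
  sum of totient(D) over D dividing f, that is f.

  Admissible f congruent to r mod p are the values u^2 + 2 v^2 with u, v coprime, u odd, and
  (u, v) congruent mod p to a point of the conic u^2 + 2 v^2 = r.  A crude sieve gives a positive
  proportion of such pairs in a box of side M.  There are O(M^2 log M) pairs of points in the box
  with equal values, by reduction to xy = zw.  By Cauchy-Schwarz there are at least a constant
  times M^2 / log M distinct values f, all O(M^2), and n = 8 f^2 is O(M^4).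
*)
theory Submission
  imports Defs "HOL-Number_Theory.Totient" "HOL-Analysis.Convex" "HOL-Analysis.Harmonic_Numbers"
    "HOL-Real_Asymp.Real_Asymp"
begin

subsection \<open>Forms of determinant \<open>2f\<^sup>2\<close> as norm forms of lattices\<close>

text \<open>The discriminants -8f^2 are chosen to make the class number an explicit function of f.
  The order of odd conductor D in Z[sqrt(-2)] has only the units 1 and -1, and its class number is D
  times the product of 1 - (-2/q)/q over the primes q dividing D. When all these q split this is the
  totient of D, which is where the totients come from, and H modulo p is governed by f alone. The
  class number formula is not invoked; the lattices are counted by hand. Prime values of f would
  give the same order of magnitude, but they call for primes in arithmetic progressions. Values u^2
  + 2 v^2 at coprime u, v avoid this, since u / v is a square root of -2 modulo the value. The price
  is that values repeat, and the second moment of the number of representations costs a logarithm;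
  this is the log X of the bound, and M^2 is the sqrt X because n has order M^4.\<close>

text \<open>The basis vectors are x1 + y1 sqrt(-2) and x2 + y2 sqrt(-2), and \<open>B\<close> is
  half the middle coefficient. The last equation forces A C - B^2 = 2 f^2 and also fixes the
  orientation of the basis, so that only moves of determinant 1 are involved later.\<close>

definition norm_repr :: "int \<Rightarrow> int \<Rightarrow> int \<Rightarrow> int \<Rightarrow> bool" where
  "norm_repr f A B C \<longleftrightarrow> (\<exists>c x1 y1 x2 y2. c > 0 \<and> A = c * (x1\<^sup>2 + 2 * y1\<^sup>2) \<and>
     B = c * (x1 * x2 + 2 * y1 * y2) \<and> C = c * (x2\<^sup>2 + 2 * y2\<^sup>2) \<and> c * (x1 * y2 - x2 * y1) = f)"

lemma norm_reprI:
  assumes "c > 0" "A = c * (x1\<^sup>2 + 2 * y1\<^sup>2)" "B = c * (x1 * x2 + 2 * y1 * y2)"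
    "C = c * (x2\<^sup>2 + 2 * y2\<^sup>2)" "c * (x1 * y2 - x2 * y1) = f"
  shows "norm_repr f A B C"
  using assms unfolding norm_repr_def by blast

text \<open>Adds \<open>k\<close> times the first basis vector to the second. With the quarter turn
  of \<open>norm_repr_swap\<close> this supplies the moves of Lagrange reduction.\<close>

lemma norm_repr_shear:
  assumes "norm_repr f A B C"
  shows "norm_repr f A (B + k * A) (C + 2 * k * B + k\<^sup>2 * A)"
proof -
  from assms obtain c x1 y1 x2 y2 where "c > 0" and *: "A = c * (x1\<^sup>2 + 2 * y1\<^sup>2)"
     "B = c * (x1 * x2 + 2 * y1 * y2)" "C = c * (x2\<^sup>2 + 2 * y2\<^sup>2)" "c * (x1 * y2 - x2 * y1) = f"
    unfolding norm_repr_def by blast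
  show ?thesis
    by (rule norm_reprI[of c _ x1 y1 _ "x2 + k * x1" "y2 + k * y1"])
      (use \<open>c > 0\<close> in \<open>auto simp: * simp flip: *(4) simp: power2_eq_square algebra_simps\<close>)
qed

lemma norm_repr_swap:
  assumes "norm_repr f A B C"
  shows "norm_repr f C (- B) A"
proof -
  from assms obtain c x1 y1 x2 y2 where "c > 0" and *: "A = c * (x1\<^sup>2 + 2 * y1\<^sup>2)"
     "B = c * (x1 * x2 + 2 * y1 * y2)" "C = c * (x2\<^sup>2 + 2 * y2\<^sup>2)" "c * (x1 * y2 - x2 * y1) = f"
    unfolding norm_repr_def by blast
  show ?thesis
    by (rule norm_reprI[of c _ x2 y2 _ "- x1" "- y1"])
      (use \<open>c > 0\<close> in \<open>auto simp: * simp flip: *(4) simp: power2_eq_square algebra_simps\<close>)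
qed

text \<open>Scales the factor \<open>c\<close>, whereas \<open>norm_repr_sublattice\<close> scales
  one basis vector. These are the ways back from g to l g when \<open>norm_repr_exists\<close>
  splits off a prime l.\<close>

lemma norm_repr_scale:
  assumes "norm_repr f A B C" "l > 0"
  shows "norm_repr (l * f) (l * A) (l * B) (l * C)"
proof -
  from assms obtain c x1 y1 x2 y2 where "c > 0" and *: "A = c * (x1\<^sup>2 + 2 * y1\<^sup>2)"
     "B = c * (x1 * x2 + 2 * y1 * y2)" "C = c * (x2\<^sup>2 + 2 * y2\<^sup>2)" "c * (x1 * y2 - x2 * y1) = f"
    unfolding norm_repr_def by blast
  show ?thesis
    by (rule norm_reprI[of "l * c" _ x1 y1 _ x2 y2])
      (use \<open>c > 0\<close> \<open>l > 0\<close> in \<open>auto simp: * simp flip: *(4) simp: power2_eq_square algebra_simps\<close>)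
qed

lemma norm_repr_sublattice:
  assumes "norm_repr f A B C"
  shows "norm_repr (l * f) (l\<^sup>2 * A) (l * B) C"
proof -
  from assms obtain c x1 y1 x2 y2 where "c > 0" and *: "A = c * (x1\<^sup>2 + 2 * y1\<^sup>2)"
     "B = c * (x1 * x2 + 2 * y1 * y2)" "C = c * (x2\<^sup>2 + 2 * y2\<^sup>2)" "c * (x1 * y2 - x2 * y1) = f"
    unfolding norm_repr_def by blast
  show ?thesis
    by (rule norm_reprI[of c _ "l * x1" "l * y1" _ x2 y2])
      (use \<open>c > 0\<close> in \<open>auto simp: * simp flip: *(4) simp: power2_eq_square algebra_simps\<close>)
qed

lemma norm_repr_sublattice':
  assumes "norm_repr f A B C"
  shows "norm_repr (l * f) A (l * B) (l\<^sup>2 * C)"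
  using norm_repr_swap[OF norm_repr_sublattice[OF norm_repr_swap[OF assms], of l]] by simp

text \<open>Class number one for discriminant -8, by Lagrange reduction with measure |B|. If 2|B| is
  at most A and C, then 4 B^2 \<le> A C = 2 + B^2, hence B = 0 and A C = 2.\<close>

lemma norm_repr_det_2:
  assumes "A * C - B\<^sup>2 = 2" "A > 0"
  shows "norm_repr 1 A B C"
  using assms
proof (induction "nat \<bar>B\<bar>" arbitrary: A B C rule: less_induct)
  case less
  have AC: "A * C = 2 + B\<^sup>2" using less.prems by simp
  have "C > 0"
  proof -
    have "A * C > 0" using AC by (smt (verit) zero_le_power2)
    then show ?thesis using less.prems(2) by (simp add: zero_less_mult_iff)
  qed
  consider "2 * \<bar>B\<bar> > A" | "2 * \<bar>B\<bar> > C" | "2 * \<bar>B\<bar> \<le> A" "2 * \<bar>B\<bar> \<le> C" by linarith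
  then show ?case
  proof cases
    case 1
    \<comment> \<open>One step of length \<open>A\<close> towards zero, not a full reduction,
      already shrinks |B| because 0 < A < 2|B|.\<close>
    define k where "k = - sgn B"
    have lt: "\<bar>B + k * A\<bar> < \<bar>B\<bar>" using 1 \<open>A > 0\<close> by (auto simp: k_def sgn_if split: if_splits)
    have "norm_repr 1 A (B + k * A) (C + 2 * k * B + k\<^sup>2 * A)"
      by (rule less.hyps) (use lt AC \<open>A > 0\<close> in \<open>auto simp: power2_eq_square algebra_simps\<close>)
    from norm_repr_shear[OF this, of "- k"] show ?thesis
      by (simp add: power2_eq_square algebra_simps)
  next
    case 2
    define k where "k = sgn B"
    have lt: "\<bar>- B + k * C\<bar> < \<bar>B\<bar>" using 2 \<open>C > 0\<close> by (auto simp: k_def sgn_if split: if_splits)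
    have "norm_repr 1 C (- B + k * C) (A + 2 * k * (- B) + k\<^sup>2 * C)"
      by (rule less.hyps) (use lt AC \<open>C > 0\<close> in \<open>auto simp: power2_eq_square algebra_simps\<close>)
    from norm_repr_swap[OF norm_repr_shear[OF this, of "- k"]] show ?thesis
      by (simp add: power2_eq_square algebra_simps)
  next
    case 3
    have "(2 * \<bar>B\<bar>) * (2 * \<bar>B\<bar>) \<le> A * C"
      by (rule mult_mono) (use 3 \<open>A > 0\<close> in auto)
    then have B2: "4 * B\<^sup>2 \<le> 2 + B\<^sup>2" using AC by (simp add: power2_eq_square flip: abs_mult)
    have "B = 0"
    proof (rule ccontr)
      assume "B \<noteq> 0"
      then have "B\<^sup>2 \<ge> 1" by (simp add: int_one_le_iff_zero_less)
      then show False using B2 by simp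
    qed
    then have "A * C = 2" using AC by simp
    have "A dvd 2" using \<open>A * C = 2\<close> by (metis dvd_triv_left)
    then have "A \<le> 2" by (simp add: zdvd_imp_le)
    then consider "A = 1" | "A = 2" using \<open>A > 0\<close> by linarith
    then show ?thesis
    proof cases
      case 1
      then show ?thesis using \<open>A * C = 2\<close> \<open>B = 0\<close>
        by (intro norm_reprI[of 1 _ 1 0 _ 0 1]) auto
    next
      case 2
      \<comment> \<open>2 x^2 + y^2 is the norm form in the basis sqrt(-2), -1; the sign gives
        determinant +1.\<close>
      then show ?thesis using \<open>A * C = 2\<close> \<open>B = 0\<close>
        by (intro norm_reprI[of 1 _ 0 1 _ "-1" 0]) auto
    qed
  qed
qed

text \<open>A prime l dividing f makes the form degenerate modulo l, so it comes from a form of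
  determinant 2 (f/l)^2. If l does not divide A, a shear makes B divisible by l, and then l^2
  divides C: a sublattice of index l. If l divides A, it divides B, and the determinant leaves two
  cases: l^2 divides A (again a sublattice) or l divides the whole form (scaling).\<close>

lemma norm_repr_exists:
  fixes f :: nat
  assumes "A * C - B\<^sup>2 = 2 * (int f)\<^sup>2" "A > 0" "f > 0"
  shows "norm_repr (int f) A B C"
  using assms
proof (induction f arbitrary: A B C rule: less_induct)
  case (less f)
  show ?case
  proof (cases "f = 1")
    case True
    then show ?thesis using norm_repr_det_2[of A C B] less.prems by simp
  next
    case False
    then obtain q where q: "prime q" "q dvd f" using prime_factor_nat by blast
    then obtain g where g: "f = q * g" by blast
    define l where "l = int q"
    have l: "prime l" "int f = l * int g" "l > 0" using q g by (auto simp: l_def prime_gt_0_nat)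
    have "g > 0" "g < f" using g less.prems(3) prime_gt_1_nat[OF q(1)] by auto
    show ?thesis
    proof (cases "l dvd A")
      case True
      have "B\<^sup>2 = A * C - 2 * (int f)\<^sup>2" using less.prems by simp
      then have "l dvd B\<^sup>2" using True l(2) by (simp add: power2_eq_square)
      then have "l dvd B" using l(1) prime_dvd_power by blast
      then obtain B' where B': "B = l * B'" by blast
      from True obtain A' where A': "A = l * A'" by blast
      have "l * (A' * C) = l * (l * (B'\<^sup>2 + 2 * (int g)\<^sup>2))"
        using less.prems(1) unfolding A' B' l(2) by (simp add: power2_eq_square algebra_simps)
      then have AC: "A' * C = l * (B'\<^sup>2 + 2 * (int g)\<^sup>2)" using l(3) by simp
      then have "l dvd A' \<or> l dvd C" using l(1) by (metis dvd_triv_left prime_dvd_mult_iff)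
      then show ?thesis
      proof
        assume "l dvd A'"
        then obtain A'' where A'': "A' = l * A''" by blast
        have "l * (A'' * C) = l * (B'\<^sup>2 + 2 * (int g)\<^sup>2)" using AC A'' by simp
        then have "A'' * C - B'\<^sup>2 = 2 * (int g)\<^sup>2" using l(3) by simp
        moreover have "A'' > 0" using less.prems(2) A' A'' l(3) by (simp add: zero_less_mult_iff)
        ultimately have "norm_repr (int g) A'' B' C" using less.IH \<open>g < f\<close> \<open>g > 0\<close> by blast
        from norm_repr_sublattice[OF this, of l] show ?thesis
          by (simp add: A' A'' B' l(2) power2_eq_square mult.assoc)
      next
        assume "l dvd C"
        then obtain C' where C': "C = l * C'" by blast
        have "l * (A' * C') = l * (B'\<^sup>2 + 2 * (int g)\<^sup>2)" using AC C' by simp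
        then have "A' * C' - B'\<^sup>2 = 2 * (int g)\<^sup>2" using l(3) by simp
        moreover have "A' > 0" using less.prems(2) A' l(3) by (simp add: zero_less_mult_iff)
        ultimately have "norm_repr (int g) A' B' C'" using less.IH \<open>g < f\<close> \<open>g > 0\<close> by blast
        from norm_repr_scale[OF this l(3)] show ?thesis by (simp add: A' B' C' l(2))
      qed
    next
      case False
      then have "coprime A l" using l(1) prime_imp_coprime coprime_commute by blast
      then obtain k' where k': "[A * k' = 1] (mod l)" using cong_solve_coprime_int by blast
      define k where "k = - k' * B"
      have "[B + k * A = B - (A * k') * B] (mod l)" by (simp add: k_def algebra_simps)
      also have "[B - (A * k') * B = B - 1 * B] (mod l)" using k' by (intro cong_diff cong_mult) auto
      finally have "l dvd B + k * A" by (simp add: cong_0_iff)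
      then obtain B' where B': "B + k * A = l * B'" by blast
      define C1 where "C1 = C + 2 * k * B + k\<^sup>2 * A"
      have "A * C1 - (B + k * A)\<^sup>2 = 2 * (int f)\<^sup>2"
        using less.prems(1) by (simp add: C1_def power2_eq_square algebra_simps)
      then have AC: "A * C1 = l\<^sup>2 * (B'\<^sup>2 + 2 * (int g)\<^sup>2)"
        unfolding B' l(2) by (simp add: power2_eq_square algebra_simps)
      have "l\<^sup>2 dvd A * C1" unfolding AC by simp
      moreover have "coprime (l\<^sup>2) A" using \<open>coprime A l\<close> by (simp add: coprime_commute)
      ultimately have "l\<^sup>2 dvd C1" by (simp add: coprime_dvd_mult_right_iff)
      then obtain C' where C': "C1 = l\<^sup>2 * C'" by blast
      have "A * C' - B'\<^sup>2 = 2 * (int g)\<^sup>2" using AC C' l(3) by simp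
      then have "norm_repr (int g) A B' C'" using less.IH \<open>g < f\<close> \<open>g > 0\<close> less.prems(2) by blast
      from norm_repr_sublattice'[OF this, of l]
      have "norm_repr (int f) A (B + k * A) C1" by (simp add: B' C' l(2))
      from norm_repr_shear[OF this, of "-k"] show ?thesis
        by (simp add: C1_def power2_eq_square algebra_simps)
    qed
  qed
qed

section \<open>Division and rigidity of lattice bases in Z[sqrt(-2)]\<close>

lemma cong_mult_cancel_unit:
  fixes k :: int
  assumes "[k * x = k * y] (mod m)" "coprime k m"
  shows "[x = y] (mod m)"
  using assms by (simp add: cong_mult_lcancel coprime_commute)

text \<open>The elements x + y sqrt(-2) with l dividing x + s y form an ideal with basis l, -s +
  sqrt(-2). Its Gram matrix divided by l has entries l, -s, m and determinant 2, so by class number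
  one it is a Gram matrix of Z[sqrt(-2)] itself. This amounts to division by a generator of norm l;
  it trades a factor l of the index for a factor l of the scalar.\<close>

lemma norm_divide_prime_element:
  fixes s l :: int
  assumes l: "l > 0" "l dvd s\<^sup>2 + 2"
    and dvd: "l dvd x1 + s * y1" "l dvd x2 + s * y2"
  obtains z1 w1 z2 w2 where
    "x1\<^sup>2 + 2 * y1\<^sup>2 = l * (z1\<^sup>2 + 2 * w1\<^sup>2)" "x1 * x2 + 2 * y1 * y2 = l * (z1 * z2 + 2 * w1 * w2)"
    "x2\<^sup>2 + 2 * y2\<^sup>2 = l * (z2\<^sup>2 + 2 * w2\<^sup>2)" "x1 * y2 - x2 * y1 = l * (z1 * w2 - z2 * w1)"
proof -
  from l(2) obtain m where m: "s\<^sup>2 + 2 = l * m" by blast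
  from dvd obtain k1 k2 where k: "x1 + s * y1 = l * k1" "x2 + s * y2 = l * k2" by blast
  have x: "x1 = l * k1 - s * y1" "x2 = l * k2 - s * y2" using k by auto
  have "norm_repr 1 l (- s) m"
    by (rule norm_repr_det_2) (use m l(1) in auto)
  then obtain c a b a' b' where *: "l = c * (a\<^sup>2 + 2 * b\<^sup>2)" "- s = c * (a * a' + 2 * b * b')"
    "m = c * (a'\<^sup>2 + 2 * b'\<^sup>2)" "c * (a * b' - a' * b) = 1" "c > 0"
    unfolding norm_repr_def by blast
  have "c = 1" using *(4,5) by (metis pos_zmult_eq_1_iff)
  with * have **: "l = a\<^sup>2 + 2 * b\<^sup>2" "s = - (a * a' + 2 * b * b')" "m = a'\<^sup>2 + 2 * b'\<^sup>2"
    "a * b' - a' * b = 1" by auto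
  have inner: "(l * u - s * y) * (l * u' - s * y') + 2 * y * y' =
      l * ((u * a + y * a') * (u' * a + y' * a') + 2 * (u * b + y * b') * (u' * b + y' * b'))"
    for u y u' y'
  proof -
    have "(l * u - s * y) * (l * u' - s * y') + 2 * y * y' =
      l * (l * u * u') - s * l * (u * y' + u' * y) + (s\<^sup>2 + 2) * y * y'"
      by (simp add: power2_eq_square algebra_simps)
    also have "\<dots> = l * (l * u * u' - s * (u * y' + u' * y) + m * y * y')"
      unfolding m by (simp add: algebra_simps)
    also have "l * u * u' - s * (u * y' + u' * y) + m * y * y' =
      (u * a + y * a') * (u' * a + y' * a') + 2 * (u * b + y * b') * (u' * b + y' * b')"
      unfolding **(1-3) by (simp add: power2_eq_square algebra_simps)
    finally show ?thesis .
  qed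
  have "x1 * y2 - x2 * y1 = l * (k1 * y2 - k2 * y1) * (a * b' - a' * b)"
    unfolding **(4) x by (simp add: algebra_simps)
  then show ?thesis
    by (intro that[of "k1 * a + y1 * a'" "k1 * b + y1 * b'" "k2 * a + y2 * a'" "k2 * b + y2 * b'"])
      (use inner[of k1 y1 k1 y1] inner[of k1 y1 k2 y2] inner[of k2 y2 k2 y2] in
        \<open>auto simp: x power2_eq_square algebra_simps\<close>)
qed

text \<open>Write Xi = xi + yi sqrt(-2) and Zi = zi + wi sqrt(-2). Equal Gram matrices and
  orientations give Zi = rho Xi with one rho of norm 1 in the field. Primitivity writes 1 as an
  integral combination of the Gram entries, which puts rho into Z[sqrt(-2)], where norm 1 means 1 or
  -1.\<close>

lemma same_gram_imp_eq_up_to_sign: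
  fixes x1 y1 x2 y2 :: int
  assumes prim: "gcd (x1\<^sup>2 + 2 * y1\<^sup>2) (gcd (2 * (x1 * x2 + 2 * y1 * y2)) (x2\<^sup>2 + 2 * y2\<^sup>2)) = 1"
    and eq: "x1\<^sup>2 + 2 * y1\<^sup>2 = z1\<^sup>2 + 2 * w1\<^sup>2" "x1 * x2 + 2 * y1 * y2 = z1 * z2 + 2 * w1 * w2"
      "x2\<^sup>2 + 2 * y2\<^sup>2 = z2\<^sup>2 + 2 * w2\<^sup>2" "x1 * y2 - x2 * y1 = z1 * w2 - z2 * w1"
    and nz: "x1 * y2 - x2 * y1 \<noteq> 0"
  obtains e where "e = 1 \<or> e = -1" "z1 = e * x1" "w1 = e * y1" "z2 = e * x2" "w2 = e * y2"
proof -
  have N2: "x2\<^sup>2 + 2 * y2\<^sup>2 \<noteq> 0" and N1: "x1\<^sup>2 + 2 * y1\<^sup>2 \<noteq> 0"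
    using nz by (auto simp: add_nonneg_eq_0_iff)
  obtain g1 g2 where g: "g1 * (x1\<^sup>2 + 2 * y1\<^sup>2)
      + g2 * gcd (2 * (x1 * x2 + 2 * y1 * y2)) (x2\<^sup>2 + 2 * y2\<^sup>2) = 1"
    using bezout_int prim by metis
  obtain h1 h2 where h: "h1 * (2 * (x1 * x2 + 2 * y1 * y2)) + h2 * (x2\<^sup>2 + 2 * y2\<^sup>2)
      = gcd (2 * (x1 * x2 + 2 * y1 * y2)) (x2\<^sup>2 + 2 * y2\<^sup>2)"
    using bezout_int by metis
  define e1 e2 e3 where "e1 = g1" and "e2 = g2 * h1" and "e3 = g2 * h2"
  have one: "e1 * (x1\<^sup>2 + 2 * y1\<^sup>2) + e2 * (2 * (x1 * x2 + 2 * y1 * y2)) + e3 * (x2\<^sup>2 + 2 * y2\<^sup>2) = 1"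
    using g unfolding h[symmetric] e1_def e2_def e3_def by (simp add: algebra_simps)
  have "(x2\<^sup>2 + 2 * y2\<^sup>2) * (z1 * x2 - 2 * w1 * y2) = (x2\<^sup>2 + 2 * y2\<^sup>2) * (x1 * z2 - 2 * y1 * w2)"
    using eq by algebra
  \<comment> \<open>\<open>p1\<close> and \<open>p2\<close> are the two components of Z1 X2 = X1 Z2,
    that is, both quotients Zi / Xi agree.\<close>
  with N2 have p1: "z1 * x2 - 2 * w1 * y2 = x1 * z2 - 2 * y1 * w2" by simp
  have "(x2\<^sup>2 + 2 * y2\<^sup>2) * (z1 * y2 + w1 * x2) = (x2\<^sup>2 + 2 * y2\<^sup>2) * (x1 * w2 + y1 * z2)"
    using eq by algebra
  with N2 have p2: "z1 * y2 + w1 * x2 = x1 * w2 + y1 * z2" by simp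
  \<comment> \<open>u and v are the conjugates of e1 X1 + e2 X2 and e2 X1 + e3 X2. Then p + q
    sqrt(-2) = u Z1 + v Z2 equals rho times the combination \<open>one\<close>, hence rho.\<close>
  define ux uy vx vy where "ux = e1 * x1 + e2 * x2" and "uy = - (e1 * y1 + e2 * y2)"
    and "vx = e2 * x1 + e3 * x2" and "vy = - (e2 * y1 + e3 * y2)"
  define p q where "p = ux * z1 - 2 * uy * w1 + vx * z2 - 2 * vy * w2"
    and "q = ux * w1 + uy * z1 + vx * w2 + vy * z2"
  note defs = p_def q_def ux_def uy_def vx_def vy_def
  have z1: "z1 = p * x1 - 2 * q * y1" and w1: "w1 = p * y1 + q * x1"
    and z2: "z2 = p * x2 - 2 * q * y2" and w2: "w2 = p * y2 + q * x2"
    using one p1 p2 unfolding defs by algebra+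
  have "z1\<^sup>2 + 2 * w1\<^sup>2 = (p\<^sup>2 + 2 * q\<^sup>2) * (x1\<^sup>2 + 2 * y1\<^sup>2)"
    unfolding z1 w1 by (simp add: power2_eq_square algebra_simps)
  with eq(1) have "(p\<^sup>2 + 2 * q\<^sup>2) * (x1\<^sup>2 + 2 * y1\<^sup>2) = 1 * (x1\<^sup>2 + 2 * y1\<^sup>2)" by simp
  with N1 have pq: "p\<^sup>2 + 2 * q\<^sup>2 = 1" by (metis mult_cancel_right)
  have "q = 0"
  proof (rule ccontr)
    assume "q \<noteq> 0"
    then have "q\<^sup>2 \<ge> 1" by (simp add: int_one_le_iff_zero_less)
    with pq show False using zero_le_power2[of p] by linarith
  qed
  moreover from this pq have "p = 1 \<or> p = -1" by (simp add: power2_eq_1_iff)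
  ultimately show ?thesis using that[of p] z1 w1 z2 w2 by simp
qed

subsection \<open>The class number of discriminant \<open>-8f\<^sup>2\<close>\<close>

lemma prime_dvd_gcd_eq_1I:
  fixes a b :: int
  assumes "\<And>q. prime q \<Longrightarrow> q dvd a \<Longrightarrow> q dvd b \<Longrightarrow> False" "a \<noteq> 0 \<or> b \<noteq> 0"
  shows "gcd a b = 1"
proof (rule ccontr)
  assume "gcd a b \<noteq> 1"
  then have "\<not> is_unit (gcd a b)" by simp
  moreover have "gcd a b \<noteq> 0" using assms(2) by simp
  ultimately obtain q where "prime q" "q dvd gcd a b"
    using prime_divisor_exists by blast
  then show False using assms(1) by auto
qed

section \<open>Norm forms of lattice bases and the action of SL2(Z)\<close>

definition nform :: "int \<Rightarrow> int \<Rightarrow> int \<Rightarrow> int \<Rightarrow> int \<Rightarrow> bqf" where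
  "nform c x1 y1 x2 y2 =
     (c * (x1\<^sup>2 + 2 * y1\<^sup>2), c * (2 * (x1 * x2 + 2 * y1 * y2)), c * (x2\<^sup>2 + 2 * y2\<^sup>2))"

text \<open>Substitution changes the basis by the columns of \<open>A\<close> and leaves scalar and
  lattice alone, so a class of forms corresponds to a lattice rather than to a basis.\<close>

lemma bqf_act_nform:
  "bqf_act (nform c x1 y1 x2 y2) A =
     nform c (A$1$1 * x1 + A$2$1 * x2) (A$1$1 * y1 + A$2$1 * y2)
             (A$1$2 * x1 + A$2$2 * x2) (A$1$2 * y1 + A$2$2 * y2)"
  by (simp add: bqf_act_def nform_def power2_eq_square algebra_simps)

lemma pos_def_iff: "pos_def (a, b, c) \<longleftrightarrow> a > 0 \<and> b\<^sup>2 - 4 * a * c < 0"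
proof (intro iffI conjI)
  assume *: "pos_def (a, b, c)"
  from * have "bqf_eval (a, b, c) 1 0 > 0" unfolding pos_def_def by force
  then show "a > 0" by (simp add: bqf_eval_def)
  from * have "bqf_eval (a, b, c) (- b) (2 * a) > 0" unfolding pos_def_def using \<open>a > 0\<close> by force
  moreover have "bqf_eval (a, b, c) (- b) (2 * a) = a * (4 * a * c - b\<^sup>2)"
    by (simp add: bqf_eval_def power2_eq_square algebra_simps)
  ultimately show "b\<^sup>2 - 4 * a * c < 0" using \<open>a > 0\<close> by (simp add: zero_less_mult_iff)
next
  assume *: "a > 0 \<and> b\<^sup>2 - 4 * a * c < 0"
  have "bqf_eval (a, b, c) x y > 0" if "(x, y) \<noteq> (0, 0)" for x y
  proof -
    have eq: "4 * a * bqf_eval (a, b, c) x y = (2 * a * x + b * y)\<^sup>2 + (4 * a * c - b\<^sup>2) * y\<^sup>2"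
      by (simp add: bqf_eval_def power2_eq_square algebra_simps)
    have "\<dots> > 0"
    proof (cases "y = 0")
      case True
      then show ?thesis using that * by simp
    next
      case False
      then have "(4 * a * c - b\<^sup>2) * y\<^sup>2 > 0" using * by simp
      then show ?thesis using zero_le_power2[of "2 * a * x + b * y"] by linarith
    qed
    then show ?thesis using * unfolding eq[symmetric] by (simp add: zero_less_mult_iff)
  qed
  then show "pos_def (a, b, c)" by (auto simp: pos_def_def)
qed

text \<open>The vectors \<open>x1 + y1 \<surd>-2\<close> and \<open>x2 + y2 \<surd>-2\<close> span a lattice of index \<open>D\<close>, and
  \<open>x + y \<surd>-2 \<mapsto> x \<plusminus> s y\<close> are its two projections to the integers modulo \<open>D\<close>, where
  \<open>s\<^sup>2 = -2\<close>. The lattice is the graph of multiplication by \<open>t\<close>.\<close>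

definition unit_repr :: "nat \<Rightarrow> int \<Rightarrow> nat \<Rightarrow> nat \<Rightarrow> bqf \<Rightarrow> bool" where
  "unit_repr f s D t Q \<longleftrightarrow> (\<exists>x1 y1 x2 y2. x1 * y2 - x2 * y1 = int D \<and>
     Q = nform (int (f div D)) x1 y1 x2 y2 \<and>
     [x1 - s * y1 = int t * (x1 + s * y1)] (mod int D) \<and>
     [x2 - s * y2 = int t * (x2 + s * y2)] (mod int D) \<and>
     gcd (gcd (x1 + s * y1) (x2 + s * y2)) (int D) = 1)"

text \<open>Add to y the multiple j m, where j collects the primes of x' not dividing y. A prime of
  x' divides exactly one of y and j m: if it divides y, it misses j by construction and misses m by
  the gcd assumption.\<close>

lemma exists_coprime_lift:
  fixes x y m :: int
  assumes "gcd (gcd x y) m = 1" "m > 0"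
  obtains x' y' where "[x' = x] (mod m)" "[y' = y] (mod m)" "coprime x' y'"
proof -
  \<comment> \<open>A zero would have no finite set of prime divisors, so it is replaced by
    \<open>m\<close>, which is congruent to it.\<close>
  define x' where "x' = (if x = 0 then m else x)"
  have x': "[x' = x] (mod m)" "x' \<noteq> 0" using assms(2) by (auto simp: x'_def cong_0_iff)
  define j where "j = \<Prod>{q \<in> prime_factors x'. \<not> q dvd y}"
  have "gcd (y + j * m) x' = 1"
  proof (rule prime_dvd_gcd_eq_1I)
    show "y + j * m \<noteq> 0 \<or> x' \<noteq> 0" using x' by simp
    fix q assume q: "prime q" "q dvd y + j * m" "q dvd x'"
    then have mem: "q \<in> prime_factors x'" using x'(2) by (simp add: prime_factors_dvd)
    show False
    proof (cases "q dvd y")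
      case False
      with mem have "q dvd j" unfolding j_def by (intro dvd_prodI) auto
      with q(2) False show False by (metis dvd_add_left_iff dvd_mult2)
    next
      case True
      with q have "q dvd j * m" by (simp add: dvd_add_right_iff)
      then consider "q dvd j" | "q dvd m" using q(1) by (auto simp: prime_dvd_mult_iff)
      then show False
      proof cases
        case 1
        then obtain q' where q': "q' \<in> prime_factors x'" "\<not> q' dvd y" "q dvd q'"
          unfolding j_def using q(1) by (auto simp: prime_dvd_prod_iff)
        then have "q = q'" using q(1) by (auto intro: primes_dvd_imp_eq)
        with q' True show False by simp
      next
        case 2
        then have "q dvd x" using q(3) unfolding x'_def by (auto split: if_splits)
        then have "q dvd gcd (gcd x y) m" using True 2 by simp
        then show False using assms(1) q(1) by (simp add: not_prime_unit)
      qed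
    qed
  qed
  then have "coprime x' (y + j * m)" by (simp add: coprime_iff_gcd_eq_1 gcd.commute)
  moreover have "[y + j * m = y] (mod m)" by (simp add: cong_iff_dvd_diff)
  ultimately show ?thesis using that x'(1) by blast
qed

lemma unit_reprE:
  assumes "unit_repr f s D t Q"
  obtains x1 y1 x2 y2 where "x1 * y2 - x2 * y1 = int D"
    "Q = nform (int (f div D)) x1 y1 x2 y2"
    "[x1 - s * y1 = int t * (x1 + s * y1)] (mod int D)"
    "[x2 - s * y2 = int t * (x2 + s * y2)] (mod int D)"
    "gcd (gcd (x1 + s * y1) (x2 + s * y2)) (int D) = 1"
  using assms unfolding unit_repr_def by (elim exE conjE) (rule that)

lemma bqf_disc_nform: "bqf_disc (nform c x1 y1 x2 y2) = - 8 * (c * (x1 * y2 - x2 * y1))\<^sup>2"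
  by (simp add: bqf_disc_def nform_def power2_eq_square algebra_simps)

lemma SL2Z_uminus: "A \<in> SL2Z \<Longrightarrow> - A \<in> SL2Z"
  by (simp add: SL2Z_def det_2)

lemma mat_1_in_SL2Z: "mat 1 \<in> SL2Z"
  by (simp add: SL2Z_def)

lemma SL2Z_inverse:
  assumes "A \<in> SL2Z"
  obtains B where "B \<in> SL2Z" "A ** B = mat 1"
proof -
  define B :: "int ^ 2 ^ 2" where "B = vector [vector [A$2$2, - A$1$2], vector [- A$2$1, A$1$1]]"
  have ent: "B$1$1 = A$2$2" "B$1$2 = - A$1$2" "B$2$1 = - A$2$1" "B$2$2 = A$1$1"
    by (simp_all add: B_def)
  have d: "A$1$1 * A$2$2 - A$1$2 * A$2$1 = 1" using assms by (simp add: SL2Z_def det_2)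
  show ?thesis
  proof (rule that[of B])
    show "B \<in> SL2Z" using d by (simp add: SL2Z_def det_2 ent algebra_simps)
    show "A ** B = mat 1" using d
      by (simp add: vec_eq_iff forall_2 matrix_matrix_mult_def sum_2 ent mat_def algebra_simps)
  qed
qed

lemma bqf_act_mat_1: "bqf_act Q (mat 1) = Q"
  by (cases Q) (simp add: bqf_act_def mat_def)

lemma equiv_bqf_equiv: "equiv (pos_def_forms D) (bqf_equiv D)"
proof (rule equivI)
  show "bqf_equiv D \<subseteq> pos_def_forms D \<times> pos_def_forms D" by (auto simp: bqf_equiv_def)
  show "refl_on (pos_def_forms D) (bqf_equiv D)"
  proof (rule refl_onI)
    fix Q assume "Q \<in> pos_def_forms D"
    moreover have "\<exists>A\<in>SL2Z. Q = bqf_act Q A" using mat_1_in_SL2Z bqf_act_mat_1[of Q] by metis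
    ultimately show "(Q, Q) \<in> bqf_equiv D" by (simp add: bqf_equiv_def)
  qed
  show "sym (bqf_equiv D)"
  proof (rule symI)
    fix P Q assume "(P, Q) \<in> bqf_equiv D"
    then obtain A where *: "P \<in> pos_def_forms D" "Q \<in> pos_def_forms D" "A \<in> SL2Z" "Q = bqf_act P A"
      by (auto simp: bqf_equiv_def)
    obtain B where "B \<in> SL2Z" "A ** B = mat 1" using SL2Z_inverse *(3) by blast
    then have "P = bqf_act Q B" using * by (simp add: bqf_act_mult bqf_act_mat_1)
    then show "(Q, P) \<in> bqf_equiv D" using * \<open>B \<in> SL2Z\<close> by (auto simp: bqf_equiv_def)
  qed
  show "trans (bqf_equiv D)"
  proof (rule transI)
    fix P Q R assume "(P, Q) \<in> bqf_equiv D" "(Q, R) \<in> bqf_equiv D"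
    then obtain A B where *: "P \<in> pos_def_forms D" "R \<in> pos_def_forms D" "A \<in> SL2Z" "B \<in> SL2Z"
      "Q = bqf_act P A" "R = bqf_act Q B"
      by (auto simp: bqf_equiv_def)
    have "A ** B \<in> SL2Z" using * by (simp add: SL2Z_def det_mul)
    then show "(P, R) \<in> bqf_equiv D" using * by (auto simp: bqf_equiv_def bqf_act_mult)
  qed
qed

lemma PSL2Z_stabilizer_trivial:
  assumes "\<And>A. A \<in> SL2Z \<Longrightarrow> bqf_act Q A = Q \<Longrightarrow> A = mat 1 \<or> A = - mat 1"
  shows "PSL2Z_stabilizer Q = {{mat 1, - mat 1}}"
proof -
  define r :: "((int ^ 2 ^ 2) \<times> (int ^ 2 ^ 2)) set"
    where "r = {(A, B). A \<in> SL2Z \<and> B \<in> SL2Z \<and> (B = A \<or> B = - A)}"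
  have coset: "r `` {A} = {A, - A}" if "A \<in> SL2Z" for A
    using that SL2Z_uminus by (auto simp: r_def)
  have PSL: "PSL2Z = (\<lambda>A. {A, - A}) ` SL2Z"
    unfolding PSL2Z_def r_def[symmetric] quotient_def using coset by auto
  have "P = {mat 1, - mat 1}" if P: "P \<in> PSL2Z_stabilizer Q" for P
  proof -
    from P obtain A where A: "A \<in> SL2Z" "P = {A, - A}" "bqf_act Q A = Q"
      unfolding PSL2Z_stabilizer_def PSL by auto
    then show ?thesis using assms[of A] by auto
  qed
  moreover have "{mat 1, - mat 1} \<in> PSL2Z_stabilizer Q"
  proof -
    have "{mat 1, - mat 1} \<in> PSL2Z" unfolding PSL using mat_1_in_SL2Z by (rule imageI)
    moreover have "\<forall>A\<in>{mat 1, - mat 1}. bqf_act Q A = Q"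
      using bqf_act_mat_1 bqf_act_uminus by simp
    ultimately show ?thesis unfolding PSL2Z_stabilizer_def by blast
  qed
  ultimately show ?thesis by blast
qed

section \<open>Classes as pairs (D, t), for odd f and s^2 = -2 modulo f\<close>

context
  fixes f :: nat and s :: int
  assumes odd_f: "odd f" and s: "int f dvd s\<^sup>2 + 2"
begin

lemma f_pos: "f > 0"
  using odd_f by (rule odd_pos)

text \<open>A common divisor of s and D divides (s^2 + 2) - s^2 = 2, and D is odd. Invertibility of
  2s modulo D is what makes x + s y and x - s y independent coordinates, even when D is not
  squarefree.\<close>

lemma coprime_divisor:
  assumes "D dvd f"
  shows "coprime (2 * s) (int D)" "odd D" "D > 0" "int D dvd s\<^sup>2 + 2"
proof -
  show oddD: "odd D" using odd_f assms by auto
  show "D > 0" using f_pos assms by auto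
  show dvd: "int D dvd s\<^sup>2 + 2" using assms s by (metis dvd_trans int_dvd_int_iff)
  have c2: "coprime 2 (int D)" using oddD by simp
  have "coprime s (int D)"
  proof (rule coprimeI)
    fix d assume d: "d dvd s" "d dvd int D"
    then have "d dvd (s\<^sup>2 + 2) - s\<^sup>2" using dvd by (metis dvd_diff dvd_power dvd_trans zero_less_numeral)
    then have "d dvd 2" by simp
    with c2 d(2) show "is_unit d" using coprime_common_divisor by blast
  qed
  with c2 show "coprime (2 * s) (int D)" by simp
qed

lemma unit_repr_exists:
  assumes "Q \<in> pos_def_forms (- int (8 * f\<^sup>2))"
  obtains D t where "D dvd f" "t \<in> totatives D" "unit_repr f s D t Q"
proof -
  obtain A B2 C where Q: "Q = (A, B2, C)" by (cases Q)
  have disc: "B2\<^sup>2 - 4 * A * C = - 8 * (int f)\<^sup>2" and "A > 0"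
    using assms unfolding pos_def_forms_def Q by (auto simp: bqf_disc_def pos_def_iff)
  have "B2\<^sup>2 = 2 * (2 * (A * C - 2 * (int f)\<^sup>2))" using disc by simp
  then have "even (B2\<^sup>2)" by (metis dvd_triv_left)
  then obtain B where B: "B2 = 2 * B" by auto
  have "A * C - B\<^sup>2 = 2 * (int f)\<^sup>2" using disc unfolding B by simp
  then have repr: "norm_repr (int f) A B C" using norm_repr_exists \<open>A > 0\<close> f_pos by blast
  \<comment> \<open>The index is carried along as a natural number so that a representation of least
    index can be chosen.\<close>
  define P where "P = (\<lambda>(n::nat) c x1 y1 x2 y2. c > 0 \<and> A = c * (x1\<^sup>2 + 2 * y1\<^sup>2) \<and>
     B = c * (x1 * x2 + 2 * y1 * y2) \<and> C = c * (x2\<^sup>2 + 2 * y2\<^sup>2) \<and> c * (x1 * y2 - x2 * y1) = int f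
     \<and> n = nat (x1 * y2 - x2 * y1))"
  have ex: "\<exists>n c x1 y1 x2 y2. P n c x1 y1 x2 y2"
    using repr unfolding norm_repr_def P_def by blast
  define D where "D = (LEAST n. \<exists>c x1 y1 x2 y2. P n c x1 y1 x2 y2)"
  obtain c x1 y1 x2 y2 where PD: "P D c x1 y1 x2 y2"
    using LeastI_ex[OF ex] unfolding D_def by blast
  have min: "D \<le> n" if "P n c x1 y1 x2 y2" for n c x1 y1 x2 y2
    unfolding D_def by (rule Least_le) (use that in blast)
  have c: "c > 0" and A: "A = c * (x1\<^sup>2 + 2 * y1\<^sup>2)" and B': "B = c * (x1 * x2 + 2 * y1 * y2)"
    and C: "C = c * (x2\<^sup>2 + 2 * y2\<^sup>2)" and cD: "c * (x1 * y2 - x2 * y1) = int f"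
    and Dn: "D = nat (x1 * y2 - x2 * y1)"
    using PD unfolding P_def by auto
  have "x1 * y2 - x2 * y1 > 0" using cD c f_pos
    by (metis of_nat_0_less_iff zero_less_mult_pos)
  then have D: "x1 * y2 - x2 * y1 = int D" using Dn by simp
  have "int D dvd int f" using cD unfolding D by (metis dvd_triv_right)
  then have Df: "D dvd f" by simp
  note cop = coprime_divisor[OF Df]
  have cdiv: "c = int (f div D)" using cD cop(3) unfolding D
    by (metis div_mult_self_is_m of_nat_0_less_iff zdiv_int nonzero_mult_div_cancel_right less_irrefl)
  \<comment> \<open>Surjectivity of both projections. If a prime l of D divided both images under
    one of them, \<open>norm_divide_prime_element\<close> would replace (c, D) by (c l, D / l),
    against minimality.\<close>
  have unimod: "gcd (gcd (x1 + s' * y1) (x2 + s' * y2)) (int D) = 1" if s': "s' = s \<or> s' = - s" for s'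
  proof (rule prime_dvd_gcd_eq_1I)
    show "gcd (x1 + s' * y1) (x2 + s' * y2) \<noteq> 0 \<or> int D \<noteq> 0" using cop(3) by auto
    fix l :: int assume l: "prime l" "l dvd gcd (x1 + s' * y1) (x2 + s' * y2)" "l dvd int D"
    then have "l > 1" using prime_gt_1_int by blast
    have "l > 0" using \<open>l > 1\<close> by simp
    have "l dvd s'\<^sup>2 + 2" using s' cop(4) l(3) dvd_trans by auto
    have "l dvd x1 + s' * y1" "l dvd x2 + s' * y2" using l(2) by auto
    note norm_divide_prime_element[OF \<open>l > 0\<close> \<open>l dvd s'\<^sup>2 + 2\<close> this]
    then obtain z1 w1 z2 w2 where zw:
      "x1\<^sup>2 + 2 * y1\<^sup>2 = l * (z1\<^sup>2 + 2 * w1\<^sup>2)" "x1 * x2 + 2 * y1 * y2 = l * (z1 * z2 + 2 * w1 * w2)"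
      "x2\<^sup>2 + 2 * y2\<^sup>2 = l * (z2\<^sup>2 + 2 * w2\<^sup>2)" "x1 * y2 - x2 * y1 = l * (z1 * w2 - z2 * w1)"
      by blast
    have "P (nat (z1 * w2 - z2 * w1)) (c * l) z1 w1 z2 w2"
      unfolding P_def A B' C zw using c \<open>l > 1\<close> cD[unfolded zw(4)] by (auto simp: mult.assoc)
    from min[OF this] have "int D \<le> z1 * w2 - z2 * w1" using cop(3) by linarith
    moreover have "int D = l * (z1 * w2 - z2 * w1)" using zw(4) D by simp
    moreover have "1 * (z1 * w2 - z2 * w1) < l * (z1 * w2 - z2 * w1)"
      using calculation cop(3) \<open>l > 1\<close> by (intro mult_strict_right_mono) auto
    ultimately show False by (metis mult_1 not_le)
  qed
  define a1 a2 b1 b2 where "a1 = x1 + s * y1" and "a2 = x2 + s * y2" and "b1 = x1 - s * y1"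
    and "b2 = x2 - s * y2"
  have ga: "gcd (gcd a1 a2) (int D) = 1" using unimod[of s] by (simp add: a1_def a2_def)
  have gb: "gcd (gcd b1 b2) (int D) = 1" using unimod[of "- s"] by (simp add: b1_def b2_def)
  \<comment> \<open>The lattice determinant in the coordinates a = x + s y, b = x - s y. It vanishes
    modulo D, so the vectors (a1, a2) and (b1, b2) are proportional there.\<close>
  have "a2 * b1 - a1 * b2 = int D * (2 * s)"
    unfolding D[symmetric] a1_def a2_def b1_def b2_def by (simp add: algebra_simps)
  then have ab: "[a1 * b2 = a2 * b1] (mod int D)"
    by (metis cong_iff_dvd_diff cong_sym dvd_triv_left)
  obtain g h where g: "g * gcd a1 a2 + h * int D = 1" using bezout_int ga by metis
  obtain u1 u2 where u: "u1 * a1 + u2 * a2 = gcd a1 a2" using bezout_int by metis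
  \<comment> \<open>The Bezout functional that sends (a1, a2) to 1 modulo D, applied to (b1, b2),
    reads off the factor of proportionality.\<close>
  define T where "T = g * (u1 * b1 + u2 * b2)"
  have one: "[g * (u1 * a1 + u2 * a2) = 1] (mod int D)"
    unfolding u using g by (metis cong_iff_lin mult.commute cong_sym add.commute)
  have T1: "[T * a1 = b1] (mod int D)"
  proof -
    have "T * a1 = g * (u1 * a1) * b1 + g * u2 * (a1 * b2)" by (simp add: T_def algebra_simps)
    also have "[g * (u1 * a1) * b1 + g * u2 * (a1 * b2) = g * (u1 * a1) * b1 + g * u2 * (a2 * b1)] (mod int D)"
      by (intro cong_add cong_mult ab cong_refl)
    also have "g * (u1 * a1) * b1 + g * u2 * (a2 * b1) = g * (u1 * a1 + u2 * a2) * b1"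
      by (simp add: algebra_simps)
    also have "[\<dots> = 1 * b1] (mod int D)" by (intro cong_mult one cong_refl)
    finally show ?thesis by simp
  qed
  have T2: "[T * a2 = b2] (mod int D)"
  proof -
    have "T * a2 = g * u1 * (a2 * b1) + g * (u2 * a2) * b2" by (simp add: T_def algebra_simps)
    also have "[g * u1 * (a2 * b1) + g * (u2 * a2) * b2 = g * u1 * (a1 * b2) + g * (u2 * a2) * b2] (mod int D)"
      by (intro cong_add cong_mult cong_sym[OF ab] cong_refl)
    also have "g * u1 * (a1 * b2) + g * (u2 * a2) * b2 = g * (u1 * a1 + u2 * a2) * b2"
      by (simp add: algebra_simps)
    also have "[\<dots> = 1 * b2] (mod int D)" by (intro cong_mult one cong_refl)
    finally show ?thesis by simp
  qed
  have copT: "coprime T (int D)"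
  proof (rule coprimeI)
    fix d assume d: "d dvd T" "d dvd int D"
    have "d dvd b1" using T1 d by (meson cong_dvd_iff cong_dvd_modulus dvd_mult2)
    moreover have "d dvd b2" using T2 d by (meson cong_dvd_iff cong_dvd_modulus dvd_mult2)
    ultimately have "d dvd gcd (gcd b1 b2) (int D)" using d by simp
    then show "is_unit d" using gb by simp
  qed
  \<comment> \<open>The only totative of 1 is 1, whereas reduction modulo 1 would give 0.\<close>
  define t where "t = (if D = 1 then 1 else nat (T mod int D))"
  have tT: "[int t = T] (mod int D)"
    using cop(3) by (auto simp: t_def cong_def)
  have "coprime (int t) (int D)" using copT tT cong_sym by (metis cong_imp_coprime)
  then have "coprime t D" by simp
  moreover have "t \<le> D" using cop(3) unfolding t_def
    by (auto intro!: nat_le_iff[THEN iffD2] less_imp_le[OF pos_mod_bound])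
  moreover have "t > 0"
  proof (rule ccontr)
    assume "\<not> t > 0"
    then show False using \<open>coprime t D\<close> unfolding t_def by (auto split: if_splits)
  qed
  ultimately have "t \<in> totatives D" by (simp add: in_totatives_iff)
  moreover have "unit_repr f s D t Q"
    unfolding unit_repr_def
  proof (intro exI conjI)
    show "x1 * y2 - x2 * y1 = int D" by fact
    show "Q = nform (int (f div D)) x1 y1 x2 y2"
      unfolding Q nform_def cdiv[symmetric] B A B' C by simp
    have "[int t * a1 = b1] (mod int D)" using T1 tT by (meson cong_mult cong_refl cong_trans)
    then show "[x1 - s * y1 = int t * (x1 + s * y1)] (mod int D)"
      by (simp add: a1_def b1_def cong_sym)
    have "[int t * a2 = b2] (mod int D)" using T2 tT by (meson cong_mult cong_refl cong_trans)
    then show "[x2 - s * y2 = int t * (x2 + s * y2)] (mod int D)"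
      by (simp add: a2_def b2_def cong_sym)
    show "gcd (gcd (x1 + s * y1) (x2 + s * y2)) (int D) = 1" using unimod by simp
  qed
  ultimately show ?thesis using that Df by blast
qed

lemma nform_pos_def:
  assumes "D dvd f" "x1 * y2 - x2 * y1 = int D"
  shows "nform (int (f div D)) x1 y1 x2 y2 \<in> pos_def_forms (- int (8 * f\<^sup>2))"
proof -
  have "f > 0" by (rule f_pos)
  have D: "D > 0" using coprime_divisor assms(1) by blast
  have fD: "int (f div D) * int D = int f" using assms(1) by (simp flip: of_nat_mult)
  have pos: "int (f div D) > 0" using assms(1) \<open>f > 0\<close> D by (simp add: div_greater_zero_iff dvd_imp_le)
  have disc: "bqf_disc (nform (int (f div D)) x1 y1 x2 y2) = - int (8 * f\<^sup>2)"
    unfolding bqf_disc_nform assms(2) fD by simp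
  have "x1 \<noteq> 0 \<or> y1 \<noteq> 0" using assms(2) D by auto
  then have "x1\<^sup>2 + 2 * y1\<^sup>2 > 0"
    by (auto intro: add_pos_nonneg add_nonneg_pos)
  then have "int (f div D) * (x1\<^sup>2 + 2 * y1\<^sup>2) > 0" using pos by simp
  moreover have "bqf_disc (nform (int (f div D)) x1 y1 x2 y2) < 0" unfolding disc using \<open>f > 0\<close> by simp
  ultimately have "pos_def (nform (int (f div D)) x1 y1 x2 y2)"
    unfolding nform_def pos_def_iff bqf_disc_def by simp
  then show ?thesis using disc by (simp add: pos_def_forms_def)
qed

text \<open>The graph of \<open>t\<close> contains (1, t). Solving x + s y = 1 and x - s y = t
  modulo D, and lifting to a primitive vector, gives a first basis vector; the second is D times a
  complement of it.\<close>

lemma unit_repr_form: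
  assumes D: "D dvd f" and t: "t \<in> totatives D"
  obtains Q where "Q \<in> pos_def_forms (- int (8 * f\<^sup>2))" "unit_repr f s D t Q"
proof -
  note cop = coprime_divisor[OF D]
  have "coprime 2 (int D)" using cop(2) by simp
  then obtain h where h: "[2 * h = 1] (mod int D)" using cong_solve_coprime_int by blast
  obtain k where k: "[2 * s * k = 1] (mod int D)" using cong_solve_coprime_int cop(1) by blast
  \<comment> \<open>\<open>h\<close> and \<open>k\<close> invert 2 and 2s modulo D, so these are (1
    + t) / 2 and (1 - t) / (2s).\<close>
  define x y where "x = (1 + int t) * h" and "y = (1 - int t) * k"
  have "[2 * h = 2 * (s * k)] (mod int D)" using h k by (metis cong_sym cong_trans mult.assoc)
  then have hk: "[h = s * k] (mod int D)"
    using \<open>coprime 2 (int D)\<close> by (rule cong_mult_cancel_unit)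
  have phi: "[x + s * y = 1] (mod int D)"
  proof -
    have "x + s * y = (1 + int t) * h + (1 - int t) * (s * k)"
      by (simp add: x_def y_def algebra_simps)
    also have "[\<dots> = (1 + int t) * h + (1 - int t) * h] (mod int D)"
      by (intro cong_add cong_mult cong_refl cong_sym[OF hk])
    also have "(1 + int t) * h + (1 - int t) * h = 2 * h" by (simp add: algebra_simps)
    also note h
    finally show ?thesis .
  qed
  have psi: "[x - s * y = int t] (mod int D)"
  proof -
    have "x - s * y = (1 + int t) * h - (1 - int t) * (s * k)"
      by (simp add: x_def y_def algebra_simps)
    also have "[\<dots> = (1 + int t) * h - (1 - int t) * h] (mod int D)"
      by (intro cong_diff cong_mult cong_refl cong_sym[OF hk])
    also have "(1 + int t) * h - (1 - int t) * h = int t * (2 * h)" by (simp add: algebra_simps)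
    also have "[\<dots> = int t * 1] (mod int D)" by (intro cong_mult h cong_refl)
    finally show ?thesis by simp
  qed
  have "gcd (gcd x y) (int D) dvd x + s * y" by (meson dvd_add dvd_mult gcd_dvd1 gcd_dvd2 dvd_trans)
  then have "gcd (gcd x y) (int D) dvd 1" using phi
    by (meson cong_dvd_iff cong_dvd_modulus gcd_dvd2)
  then have gxy: "gcd (gcd x y) (int D) = 1" by simp
  have "int D > 0" using cop(3) by simp
  from exists_coprime_lift[OF gxy this] obtain x1 y1 where xy: "[x1 = x] (mod int D)" "[y1 = y] (mod int D)" "coprime x1 y1"
    by blast
  obtain w2 w1 where w: "w2 * x1 + w1 * y1 = 1" using bezout_int xy(3)
    by (metis coprime_iff_gcd_eq_1)
  define x2 y2 where "x2 = - (int D * w1)" and "y2 = int D * w2"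
  have det: "x1 * y2 - x2 * y1 = int D"
  proof -
    have "x1 * y2 - x2 * y1 = int D * (w2 * x1 + w1 * y1)" by (simp add: x2_def y2_def algebra_simps)
    then show ?thesis unfolding w by simp
  qed
  have phi1: "[x1 + s * y1 = 1] (mod int D)"
    using phi xy by (meson cong_add cong_mult cong_refl cong_trans)
  have psi1: "[x1 - s * y1 = int t] (mod int D)"
    using psi xy by (meson cong_diff cong_mult cong_refl cong_trans)
  have xy2: "[x2 = 0] (mod int D)" "[y2 = 0] (mod int D)" by (auto simp: x2_def y2_def cong_0_iff)
  have "unit_repr f s D t (nform (int (f div D)) x1 y1 x2 y2)"
    unfolding unit_repr_def
  proof (intro exI conjI)
    show "x1 * y2 - x2 * y1 = int D" by (rule det)
    have "[int t * (x1 + s * y1) = int t * 1] (mod int D)" by (intro cong_mult phi1 cong_refl)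
    then show "[x1 - s * y1 = int t * (x1 + s * y1)] (mod int D)"
      using psi1 by (metis cong_sym cong_trans mult.right_neutral)
    show "[x2 - s * y2 = int t * (x2 + s * y2)] (mod int D)"
      using xy2 by (auto simp: cong_0_iff cong_iff_dvd_diff)
    have "gcd (x1 + s * y1) (int D) = 1" using cong_gcd_eq[OF phi1] by simp
    moreover have "gcd (gcd (x1 + s * y1) (x2 + s * y2)) (int D) dvd gcd (x1 + s * y1) (int D)"
      by (meson dvd_trans gcd_dvd1 gcd_dvd2 gcd_greatest)
    ultimately show "gcd (gcd (x1 + s * y1) (x2 + s * y2)) (int D) = 1" by simp
  qed (rule refl)
  with nform_pos_def[OF D det] show ?thesis by (rule that)
qed

text \<open>The congruences are linear, hence hold on the whole lattice; the gcd condition survives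
  because the inverse of \<open>A\<close> recovers the old vectors from the new ones.\<close>

lemma unit_repr_act:
  assumes "unit_repr f s D t Q" "A \<in> SL2Z"
  shows "unit_repr f s D t (bqf_act Q A)"
proof -
  from assms(1) obtain x1 y1 x2 y2 where det: "x1 * y2 - x2 * y1 = int D"
    and Q: "Q = nform (int (f div D)) x1 y1 x2 y2"
    and c1: "[x1 - s * y1 = int t * (x1 + s * y1)] (mod int D)"
    and c2: "[x2 - s * y2 = int t * (x2 + s * y2)] (mod int D)"
    and g: "gcd (gcd (x1 + s * y1) (x2 + s * y2)) (int D) = 1"
    by (rule unit_reprE)
  define a b c d where "a = A$1$1" and "b = A$1$2" and "c = A$2$1" and "d = A$2$2"
  have A: "a * d - b * c = 1" using assms(2) by (simp add: SL2Z_def det_2 a_def b_def c_def d_def)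
  have lin: "[(u * x1 + v * x2) - s * (u * y1 + v * y2) = int t * ((u * x1 + v * x2) + s * (u * y1 + v * y2))] (mod int D)"
    for u v
  proof -
    have "(u * x1 + v * x2) - s * (u * y1 + v * y2) = u * (x1 - s * y1) + v * (x2 - s * y2)"
      by (simp add: algebra_simps)
    also have "[\<dots> = u * (int t * (x1 + s * y1)) + v * (int t * (x2 + s * y2))] (mod int D)"
      by (intro cong_add cong_mult cong_refl c1 c2)
    also have "u * (int t * (x1 + s * y1)) + v * (int t * (x2 + s * y2)) =
        int t * ((u * x1 + v * x2) + s * (u * y1 + v * y2))"
      by (simp add: algebra_simps)
    finally show ?thesis .
  qed
  show ?thesis unfolding unit_repr_def
  proof (intro exI conjI)
    show "bqf_act Q A = nform (int (f div D)) (a * x1 + c * x2) (a * y1 + c * y2)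
      (b * x1 + d * x2) (b * y1 + d * y2)"
      unfolding Q bqf_act_nform a_def b_def c_def d_def ..
    have "(a * x1 + c * x2) * (b * y1 + d * y2) - (b * x1 + d * x2) * (a * y1 + c * y2)
       = (a * d - b * c) * (x1 * y2 - x2 * y1)" by (simp add: algebra_simps)
    then show "(a * x1 + c * x2) * (b * y1 + d * y2) - (b * x1 + d * x2) * (a * y1 + c * y2) = int D"
      unfolding A det by simp
    show "gcd (gcd (a * x1 + c * x2 + s * (a * y1 + c * y2)) (b * x1 + d * x2 + s * (b * y1 + d * y2))) (int D) = 1"
      (is "gcd (gcd ?p ?q) _ = 1")
    proof -
      have "d * ?p - c * ?q = (a * d - b * c) * (x1 + s * y1)" by (simp add: algebra_simps)
      moreover have "gcd (gcd ?p ?q) (int D) dvd d * ?p - c * ?q"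
        by (meson dvd_diff dvd_mult gcd_dvd1 gcd_dvd2 dvd_trans)
      ultimately have d1: "gcd (gcd ?p ?q) (int D) dvd x1 + s * y1" using A by simp
      have "a * ?q - b * ?p = (a * d - b * c) * (x2 + s * y2)" by (simp add: algebra_simps)
      moreover have "gcd (gcd ?p ?q) (int D) dvd a * ?q - b * ?p"
        by (meson dvd_diff dvd_mult gcd_dvd1 gcd_dvd2 dvd_trans)
      ultimately have d2: "gcd (gcd ?p ?q) (int D) dvd x2 + s * y2" using A by simp
      have "gcd (gcd ?p ?q) (int D) dvd gcd (gcd (x1 + s * y1) (x2 + s * y2)) (int D)"
        using d1 d2 by (meson gcd_dvd2 gcd_greatest)
      then show ?thesis unfolding g by simp
    qed
  qed (rule lin)+
qed

text \<open>Both bases lie in the graph of \<open>t\<close>, a lattice of index D, and both have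
  determinant D, so they span the same lattice. Concretely, Cramer's rule gives integral
  coefficients.\<close>

lemma unit_repr_equiv:
  assumes D: "D dvd f" and "unit_repr f s D t Q" "unit_repr f s D t R"
  obtains A where "A \<in> SL2Z" "R = bqf_act Q A"
proof -
  note cop = coprime_divisor[OF D]
  from assms(2) obtain x1 y1 x2 y2 where det: "x1 * y2 - x2 * y1 = int D"
    and Q: "Q = nform (int (f div D)) x1 y1 x2 y2"
    and c: "[x1 - s * y1 = int t * (x1 + s * y1)] (mod int D)"
     "[x2 - s * y2 = int t * (x2 + s * y2)] (mod int D)"
    by (rule unit_reprE) (rule that)
  from assms(3) obtain z1 w1 z2 w2 where det': "z1 * w2 - z2 * w1 = int D"
    and R: "R = nform (int (f div D)) z1 w1 z2 w2"
    and c': "[z1 - s * w1 = int t * (z1 + s * w1)] (mod int D)"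
     "[z2 - s * w2 = int t * (z2 + s * w2)] (mod int D)"
    by (rule unit_reprE) (rule that)
  \<comment> \<open>Any two vectors of the graph have determinant divisible by D: in the projected
    coordinates they are proportional with the same factor \<open>t\<close>, and 2s is
    invertible.\<close>
  have lat: "int D dvd x * w - z * y" if "[x - s * y = int t * (x + s * y)] (mod int D)"
    "[z - s * w = int t * (z + s * w)] (mod int D)" for x y z w
  proof -
    have "(2 * s) * (x * w - z * y) = (x - s * y) * (z + s * w) - (x + s * y) * (z - s * w)"
      by (simp add: algebra_simps)
    also have "[\<dots> = int t * (x + s * y) * (z + s * w) - (x + s * y) * (int t * (z + s * w))] (mod int D)"
      by (intro cong_diff cong_mult cong_refl that)
    also have "int t * (x + s * y) * (z + s * w) - (x + s * y) * (int t * (z + s * w)) = 0" by simp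
    finally have "int D dvd (2 * s) * (x * w - z * y)" by (simp add: cong_0_iff)
    then show ?thesis using cop(1) by (metis coprime_commute coprime_dvd_mult_right_iff)
  qed
  obtain a11 a21 a12 a22 where a: "z1 * y2 - x2 * w1 = int D * a11" "x1 * w1 - z1 * y1 = int D * a21"
    "z2 * y2 - x2 * w2 = int D * a12" "x1 * w2 - z2 * y1 = int D * a22"
    using lat[OF c'(1) c(2)] lat[OF c(1) c'(1)] lat[OF c'(2) c(2)] lat[OF c(1) c'(2)]
    by (auto simp: dvd_def)
  have nz: "int D \<noteq> 0" using cop(3) by simp
  have cramer: "a11 * x1 + a21 * x2 = z1" "a11 * y1 + a21 * y2 = w1"
    "a12 * x1 + a22 * x2 = z2" "a12 * y1 + a22 * y2 = w2"
  proof -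
    have "int D * (a11 * x1 + a21 * x2) = (x1 * y2 - x2 * y1) * z1"
      "int D * (a11 * y1 + a21 * y2) = (x1 * y2 - x2 * y1) * w1"
      "int D * (a12 * x1 + a22 * x2) = (x1 * y2 - x2 * y1) * z2"
      "int D * (a12 * y1 + a22 * y2) = (x1 * y2 - x2 * y1) * w2"
      unfolding distrib_left mult.assoc[symmetric] a[symmetric] by (auto simp: algebra_simps)
    then show "a11 * x1 + a21 * x2 = z1" "a11 * y1 + a21 * y2 = w1"
      "a12 * x1 + a22 * x2 = z2" "a12 * y1 + a22 * y2 = w2"
      unfolding det using nz by auto
  qed
  have "int D * (a11 * a22 - a12 * a21) = (x1 * y2 - x2 * y1) * (a11 * a22 - a12 * a21)"
    unfolding det ..
  also have "\<dots> = z1 * w2 - z2 * w1"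
    unfolding cramer[symmetric] by (simp add: algebra_simps)
  finally have det1: "a11 * a22 - a12 * a21 = 1" unfolding det' using nz by simp
  define A :: "int ^ 2 ^ 2" where "A = vector [vector [a11, a12], vector [a21, a22]]"
  have ent: "A$1$1 = a11" "A$1$2 = a12" "A$2$1 = a21" "A$2$2 = a22"
    by (simp_all add: A_def)
  show ?thesis
  proof (rule that[of A])
    show "A \<in> SL2Z" unfolding SL2Z_def by (simp add: det_2 ent det1)
    show "R = bqf_act Q A" unfolding Q R bqf_act_nform ent cramer ..
  qed
qed

text \<open>A prime q dividing all three entries is odd, since otherwise x1, x2 and hence D would be
  even, and it divides D by the Gram determinant. Then q divides (x - s y)(x + s y) for both
  vectors, and as \<open>t\<close> is a unit modulo q it divides both x + s y, against the gcd
  condition. This makes f / D the content of the form.\<close>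

lemma unit_repr_gram_primitive:
  assumes D: "D dvd f" and det: "x1 * y2 - x2 * y1 = int D" and t: "t \<in> totatives D"
    and c: "[x1 - s * y1 = int t * (x1 + s * y1)] (mod int D)"
     "[x2 - s * y2 = int t * (x2 + s * y2)] (mod int D)"
    and g: "gcd (gcd (x1 + s * y1) (x2 + s * y2)) (int D) = 1"
  shows "gcd (x1\<^sup>2 + 2 * y1\<^sup>2) (gcd (2 * (x1 * x2 + 2 * y1 * y2)) (x2\<^sup>2 + 2 * y2\<^sup>2)) = 1"
proof (rule prime_dvd_gcd_eq_1I)
  note cop = coprime_divisor[OF D]
  have "x1 \<noteq> 0 \<or> y1 \<noteq> 0" using det cop(3) by auto
  then show "x1\<^sup>2 + 2 * y1\<^sup>2 \<noteq> 0 \<or> gcd (2 * (x1 * x2 + 2 * y1 * y2)) (x2\<^sup>2 + 2 * y2\<^sup>2) \<noteq> 0"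
    by (auto simp: add_nonneg_eq_0_iff)
  fix q assume q: "prime q" "q dvd x1\<^sup>2 + 2 * y1\<^sup>2"
    "q dvd gcd (2 * (x1 * x2 + 2 * y1 * y2)) (x2\<^sup>2 + 2 * y2\<^sup>2)"
  then have q23: "q dvd 2 * (x1 * x2 + 2 * y1 * y2)" "q dvd x2\<^sup>2 + 2 * y2\<^sup>2" by auto
  have "q \<noteq> 2"
  proof
    assume "q = 2"
    then have "even x1" "even x2" using q(2) q23(2) by auto
    then have "even (int D)" unfolding det[symmetric] by simp
    then show False using cop(2) by simp
  qed
  then have nq2: "\<not> q dvd 2" using q(1) primes_dvd_imp_eq[of q 2] by auto
  have qI: "q dvd x1 * x2 + 2 * y1 * y2" using q(1) q23(1) nq2 by (meson prime_dvd_mult_iff)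
  have "(x1\<^sup>2 + 2 * y1\<^sup>2) * (x2\<^sup>2 + 2 * y2\<^sup>2) - (x1 * x2 + 2 * y1 * y2)\<^sup>2 = 2 * (x1 * y2 - x2 * y1)\<^sup>2"
    by (simp add: power2_eq_square algebra_simps)
  moreover have "q dvd (x1\<^sup>2 + 2 * y1\<^sup>2) * (x2\<^sup>2 + 2 * y2\<^sup>2) - (x1 * x2 + 2 * y1 * y2)\<^sup>2"
    using q(2) qI by (simp add: power2_eq_square)
  ultimately have "q dvd 2 * (int D)\<^sup>2" unfolding det by metis
  then have qD: "q dvd int D" using q(1) nq2 by (metis prime_dvd_mult_iff prime_dvd_power)
  have "\<not> q dvd int t"
  proof
    assume "q dvd int t"
    moreover have "coprime (int t) (int D)" using t by (simp add: in_totatives_iff)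
    ultimately show False using qD q(1) by (meson coprime_common_divisor not_prime_unit)
  qed
  have key: "q dvd x + s * y" if "[x - s * y = int t * (x + s * y)] (mod int D)" "q dvd x\<^sup>2 + 2 * y\<^sup>2" for x y
  proof -
    have "q dvd s\<^sup>2 + 2" using cop(4) qD by (rule dvd_trans[rotated])
    then have "q dvd (x\<^sup>2 + 2 * y\<^sup>2) - (s\<^sup>2 + 2) * y\<^sup>2" using that(2) by (metis dvd_diff dvd_mult2)
    also have "(x\<^sup>2 + 2 * y\<^sup>2) - (s\<^sup>2 + 2) * y\<^sup>2 = (x - s * y) * (x + s * y)"
      by (simp add: power2_eq_square algebra_simps)
    finally have "q dvd x - s * y \<or> q dvd x + s * y" using q(1) by (simp add: prime_dvd_mult_iff)
    moreover have "q dvd x - s * y \<longleftrightarrow> q dvd int t * (x + s * y)"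
      using that(1) qD by (meson cong_dvd_iff cong_dvd_modulus)
    ultimately show ?thesis using \<open>\<not> q dvd int t\<close> q(1) by (auto simp: prime_dvd_mult_iff)
  qed
  have "q dvd gcd (gcd (x1 + s * y1) (x2 + s * y2)) (int D)"
    using key[OF c(1) q(2)] key[OF c(2) q23(2)] qD by simp
  then show False using g q(1) by (simp add: not_prime_unit)
qed

text \<open>The content f / D of the form determines D. By rigidity the two bases then agree up to a
  common sign, so t and t' act alike on both values x + s y; these generate the unit ideal modulo D,
  and totatives of D differ by less than D.\<close>

lemma unit_repr_unique:
  assumes D: "D dvd f" "t \<in> totatives D" "unit_repr f s D t Q"
    and D': "D' dvd f" "t' \<in> totatives D'" "unit_repr f s D' t' Q"
  shows "D = D'" "t = t'"
proof -
  note f = f_pos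
  from D(3) obtain x1 y1 x2 y2 where det: "x1 * y2 - x2 * y1 = int D"
    and Q: "Q = nform (int (f div D)) x1 y1 x2 y2"
    and c: "[x1 - s * y1 = int t * (x1 + s * y1)] (mod int D)"
     "[x2 - s * y2 = int t * (x2 + s * y2)] (mod int D)"
    and g: "gcd (gcd (x1 + s * y1) (x2 + s * y2)) (int D) = 1"
    by (rule unit_reprE)
  from D'(3) obtain z1 w1 z2 w2 where det': "z1 * w2 - z2 * w1 = int D'"
    and Q': "Q = nform (int (f div D')) z1 w1 z2 w2"
    and c': "[z1 - s * w1 = int t' * (z1 + s * w1)] (mod int D')"
     "[z2 - s * w2 = int t' * (z2 + s * w2)] (mod int D')"
    and g': "gcd (gcd (z1 + s * w1) (z2 + s * w2)) (int D') = 1"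
    by (rule unit_reprE)
  note prim = unit_repr_gram_primitive[OF D(1) det D(2) c g]
  note prim' = unit_repr_gram_primitive[OF D'(1) det' D'(2) c' g']
  have content: "(case nform (int k) x1 y1 x2 y2 of (A, B, C) \<Rightarrow> gcd A (gcd B C)) = int k"
    if "gcd (x1\<^sup>2 + 2 * y1\<^sup>2) (gcd (2 * (x1 * x2 + 2 * y1 * y2)) (x2\<^sup>2 + 2 * y2\<^sup>2)) = 1"
    for k x1 y1 x2 y2
    using that unfolding nform_def by (simp add: gcd_mult_left abs_mult del: distrib_left_numeral)
  have "int (f div D) = int (f div D')"
    using content[OF prim, of "f div D"] content[OF prim', of "f div D'"]
    unfolding Q[symmetric] Q'[symmetric] by simp
  then have fD: "f div D = f div D'" by simp
  have "f div D > 0" using D(1) f by (simp add: div_greater_zero_iff dvd_imp_le dvd_pos_nat)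
  moreover have "f div D * D = f div D * D'" using D(1) D'(1) fD by (metis dvd_div_mult_self)
  ultimately show DD: "D = D'" by simp
  have nz: "int (f div D) \<noteq> 0" using \<open>f div D > 0\<close> by simp
  have "x1\<^sup>2 + 2 * y1\<^sup>2 = z1\<^sup>2 + 2 * w1\<^sup>2" "x1 * x2 + 2 * y1 * y2 = z1 * z2 + 2 * w1 * w2"
    "x2\<^sup>2 + 2 * y2\<^sup>2 = z2\<^sup>2 + 2 * w2\<^sup>2"
    using Q Q' nz unfolding fD[symmetric] nform_def by auto
  moreover have "x1 * y2 - x2 * y1 = z1 * w2 - z2 * w1" using det det' DD by simp
  moreover have "x1 * y2 - x2 * y1 \<noteq> 0"
    unfolding det using coprime_divisor(3)[OF D(1)] by simp
  ultimately obtain e where e: "e = 1 \<or> e = -1" "z1 = e * x1" "w1 = e * y1" "z2 = e * x2" "w2 = e * y2"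
    using same_gram_imp_eq_up_to_sign[OF prim] by blast
  have tt: "[int t * a = int t' * a] (mod int D)"
    if "a = x1 + s * y1 \<or> a = x2 + s * y2" for a
  proof -
    have "[int t' * (x1 + s * y1) = x1 - s * y1] (mod int D)"
      "[int t' * (x2 + s * y2) = x2 - s * y2] (mod int D)"
      using c' e(1) unfolding DD e(2-5)
      by (auto simp: cong_iff_dvd_diff algebra_simps dest: dvd_minus_iff[THEN iffD2])
    then show ?thesis using that c by (metis cong_sym cong_trans)
  qed
  define m where "m = int t - int t'"
  have "int D dvd m * (x1 + s * y1)" "int D dvd m * (x2 + s * y2)"
    using tt[of "x1 + s * y1"] tt[of "x2 + s * y2"]
    by (auto simp: cong_iff_dvd_diff m_def left_diff_distrib)
  then have "int D dvd gcd (m * (x1 + s * y1)) (m * (x2 + s * y2))" by simp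
  then have "int D dvd m * gcd (x1 + s * y1) (x2 + s * y2)"
    by (simp add: gcd_mult_left)
  moreover have "coprime (int D) (gcd (x1 + s * y1) (x2 + s * y2))"
    using g by (simp add: coprime_iff_gcd_eq_1 gcd.commute)
  ultimately have "int D dvd m" by (simp add: coprime_dvd_mult_left_iff)
  moreover have "\<bar>m\<bar> < int D"
    using D(2) D'(2) DD by (auto simp: m_def in_totatives_iff)
  ultimately have "m = 0" using zdvd_imp_le[of "int D" "\<bar>m\<bar>"] by fastforce
  then show "t = t'" by (simp add: m_def)
qed

text \<open>An automorph carries the basis to one with the same primitive Gram matrix and
  orientation, hence to plus or minus itself; linear independence then determines the
  matrix.\<close>

lemma unit_repr_stabilizer:
  assumes D: "D dvd f" "t \<in> totatives D" "unit_repr f s D t Q"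
    and A: "A \<in> SL2Z" "bqf_act Q A = Q"
  shows "A = mat 1 \<or> A = - mat 1"
proof -
  note f = f_pos
  from D(3) obtain x1 y1 x2 y2 where det: "x1 * y2 - x2 * y1 = int D"
    and Q: "Q = nform (int (f div D)) x1 y1 x2 y2"
    and c: "[x1 - s * y1 = int t * (x1 + s * y1)] (mod int D)"
     "[x2 - s * y2 = int t * (x2 + s * y2)] (mod int D)"
    and g: "gcd (gcd (x1 + s * y1) (x2 + s * y2)) (int D) = 1"
    by (rule unit_reprE)
  note prim = unit_repr_gram_primitive[OF D(1) det D(2) c g]
  have "f div D > 0" using D(1) f by (simp add: div_greater_zero_iff dvd_imp_le dvd_pos_nat)
  then have nz: "int (f div D) \<noteq> 0" by simp
  have nz': "x1 * y2 - x2 * y1 \<noteq> 0"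
    unfolding det using coprime_divisor(3)[OF D(1)] by simp
  define a11 a12 a21 a22 where a: "a11 = A$1$1" "a12 = A$1$2" "a21 = A$2$1" "a22 = A$2$2"
  have dA: "a11 * a22 - a12 * a21 = 1" using A(1) by (simp add: SL2Z_def det_2 a)
  define z1 w1 z2 w2 where zw: "z1 = a11 * x1 + a21 * x2" "w1 = a11 * y1 + a21 * y2"
    "z2 = a12 * x1 + a22 * x2" "w2 = a12 * y1 + a22 * y2"
  have "nform (int (f div D)) x1 y1 x2 y2 = nform (int (f div D)) z1 w1 z2 w2"
    using A(2) unfolding Q bqf_act_nform zw a by simp
  then have "x1\<^sup>2 + 2 * y1\<^sup>2 = z1\<^sup>2 + 2 * w1\<^sup>2" "x1 * x2 + 2 * y1 * y2 = z1 * z2 + 2 * w1 * w2"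
    "x2\<^sup>2 + 2 * y2\<^sup>2 = z2\<^sup>2 + 2 * w2\<^sup>2"
    using nz unfolding nform_def by auto
  moreover have "x1 * y2 - x2 * y1 = z1 * w2 - z2 * w1"
  proof -
    have "z1 * w2 - z2 * w1 = (a11 * a22 - a12 * a21) * (x1 * y2 - x2 * y1)"
      unfolding zw by (simp add: algebra_simps)
    then show ?thesis using dA by simp
  qed
  ultimately obtain e where e: "e = 1 \<or> e = -1" "z1 = e * x1" "w1 = e * y1" "z2 = e * x2" "w2 = e * y2"
    using same_gram_imp_eq_up_to_sign[OF prim _ _ _ _ nz'] by blast
  have "(a11 - e) * x1 + a21 * x2 = 0" "(a11 - e) * y1 + a21 * y2 = 0"
    "a12 * x1 + (a22 - e) * x2 = 0" "a12 * y1 + (a22 - e) * y2 = 0"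
    using e(2-5) unfolding zw by (auto simp: algebra_simps)
  note lin = this
  have zero: "u = 0 \<and> v = 0" if "u * x1 + v * x2 = 0" "u * y1 + v * y2 = 0" for u v
  proof -
    have "u * (x1 * y2 - x2 * y1) = y2 * (u * x1 + v * x2) - x2 * (u * y1 + v * y2)"
      "v * (x1 * y2 - x2 * y1) = x1 * (u * y1 + v * y2) - y1 * (u * x1 + v * x2)"
      by (auto simp: algebra_simps)
    then show ?thesis using nz' that by auto
  qed
  have "a11 = e" "a21 = 0" "a12 = 0" "a22 = e"
    using zero[OF lin(1,2)] zero[OF lin(3,4)] by auto
  then show ?thesis using e(1) unfolding a
    by (auto simp: vec_eq_iff forall_2 mat_def)
qed

lemma hurwitz_class_number_8_square: "hurwitz_class_number (- int (8 * f\<^sup>2)) = of_nat f"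
proof -
  let ?X = "pos_def_forms (- int (8 * f\<^sup>2))" and ?E = "bqf_equiv (- int (8 * f\<^sup>2))"
  let ?K = "SIGMA D:{D. D dvd f}. totatives D"
  note f = f_pos
  have fin: "finite {D. D dvd f}" using f by simp
  have aut: "Aut_order C = 1" if C: "C \<in> ?X // ?E" for C
  proof -
    define Q where "Q = (SOME Q. Q \<in> C)"
    have "C \<noteq> {}" "C \<subseteq> ?X"
      using in_quotient_imp_non_empty[OF equiv_bqf_equiv C] in_quotient_imp_subset[OF equiv_bqf_equiv C]
      by auto
    then have "Q \<in> ?X" unfolding Q_def using some_in_eq[of C] by blast
    then obtain D t where "D dvd f" "t \<in> totatives D" "unit_repr f s D t Q"
      using unit_repr_exists by blast
    from unit_repr_stabilizer[OF this] have "PSL2Z_stabilizer Q = {{mat 1, - mat 1}}"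
      by (rule PSL2Z_stabilizer_trivial)
    then show ?thesis unfolding Aut_order_def Q_def[symmetric] by simp
  qed
  define cls where "cls = (\<lambda>(D, t). {Q \<in> ?X. unit_repr f s D t Q})"
  \<comment> \<open>Within a fibre of the invariant (D, t) equivalence is automatic, and equivalence
    never leaves it: orbits and fibres coincide.\<close>
  have eqv: "(P, Q) \<in> ?E \<longleftrightarrow> unit_repr f s D t Q"
    if "(D, t) \<in> ?K" "P \<in> ?X" "Q \<in> ?X" "unit_repr f s D t P" for D t P Q
  proof
    assume "(P, Q) \<in> ?E"
    then show "unit_repr f s D t Q"
      using unit_repr_act[OF that(4)] by (auto simp: bqf_equiv_def)
  next
    assume "unit_repr f s D t Q"
    moreover have "D dvd f" using that by simp
    ultimately show "(P, Q) \<in> ?E"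
      using that unit_repr_equiv[OF _ that(4)] unfolding bqf_equiv_def by blast
  qed
  have "bij_betw cls ?K (?X // ?E)"
  proof (rule bij_betw_imageI)
    show "inj_on cls ?K"
    proof (rule inj_onI, clarify)
      fix D t D' t' assume *: "D dvd f" "t \<in> totatives D" "D' dvd f" "t' \<in> totatives D'"
        "cls (D, t) = cls (D', t')"
      obtain Q where "Q \<in> ?X" "unit_repr f s D t Q"
        using unit_repr_form[OF *(1,2)] .
      then have "unit_repr f s D' t' Q" using *(5) unfolding cls_def by blast
      then show "D = D' \<and> t = t'"
        using unit_repr_unique[OF *(1,2) \<open>unit_repr f s D t Q\<close> *(3,4)] by blast
    qed
    show "cls ` ?K = ?X // ?E"
    proof (intro equalityI subsetI)
      fix C assume "C \<in> cls ` ?K"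
      then obtain D t where *: "D dvd f" "t \<in> totatives D" "C = cls (D, t)" by auto
      obtain Q where Q: "Q \<in> ?X" "unit_repr f s D t Q"
        using unit_repr_form[OF *(1,2)] .
      have "C = ?E `` {Q}"
        unfolding *(3) cls_def using eqv[OF _ Q(1) _ Q(2)] * by (auto simp: bqf_equiv_def)
      then show "C \<in> ?X // ?E" using Q(1) by (simp add: quotientI)
    next
      fix C assume "C \<in> ?X // ?E"
      then obtain Q where Q: "Q \<in> ?X" "C = ?E `` {Q}" by (rule quotientE)
      obtain D t where *: "D dvd f" "t \<in> totatives D" "unit_repr f s D t Q"
        using unit_repr_exists[OF Q(1)] .
      have "C = cls (D, t)"
        unfolding Q(2) cls_def using eqv[OF _ Q(1) _ *(3)] * by (auto simp: bqf_equiv_def)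
      then show "C \<in> cls ` ?K" using * by auto
    qed
  qed
  then have "card (?X // ?E) = card ?K" by (simp add: bij_betw_same_card)
  also have "\<dots> = (\<Sum>D | D dvd f. card (totatives D))" using fin by simp
  also have "\<dots> = f" using totient_divisor_sum[of f] by (simp add: totient_def)
  finally have "card (?X // ?E) = f" .
  then show ?thesis unfolding hurwitz_class_number_def using aut by simp
qed

end

subsection \<open>Coincidences among values of \<open>u\<^sup>2 + 2v\<^sup>2\<close>\<close>

lemma harm_le_ln:
  assumes "n > 0"
  shows "harm n \<le> 1 + ln (real n)"
proof -
  obtain m where m: "n = Suc m" using assms gr0_implies_Suc by blast
  have "harm (Suc m) - ln (real (Suc m)) \<le> harm (Suc 0) - ln (real (Suc 0))"
    using decseqD[OF decseq_harm_diff_ln, of 0 m] by simp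
  then show ?thesis by (simp add: m harm_expand)
qed

text \<open>Cut the square along the diagonal. In the half v \<le> u, row u contributes u times
  1/u^2, so each half gives the harmonic sum; the diagonal is counted twice.\<close>

lemma sum_inverse_max_square:
  "(\<Sum>u=1..K. \<Sum>v=1..K. inverse (real (max u v))^2) \<le> 2 * harm K"
proof -
  define g where "g = (\<lambda>u v. if v \<le> u then inverse (real u)^2 else 0)"
  have "(\<Sum>u=1..K. \<Sum>v=1..K. g u v) = (\<Sum>u=1..K. inverse (real u))"
  proof (rule sum.cong[OF refl])
    fix u assume u: "u \<in> {1..K}"
    have "(\<Sum>v=1..K. g u v) = (\<Sum>v\<in>{v \<in> {1..K}. v \<le> u}. inverse (real u)^2)"
      unfolding g_def by (simp add: sum.If_cases Int_def)
    also have "{v \<in> {1..K}. v \<le> u} = {1..u}" using u by auto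
    also have "(\<Sum>v=1..u. inverse (real u)^2) = inverse (real u)"
      using u by (simp add: power2_eq_square)
    finally show "(\<Sum>v=1..K. g u v) = inverse (real u)" .
  qed
  then have h: "(\<Sum>u=1..K. \<Sum>v=1..K. g u v) = harm K" by (simp add: harm_def)
  have h': "(\<Sum>u=1..K. \<Sum>v=1..K. g v u) = harm K" by (subst sum.swap) (rule h)
  have "(\<Sum>u=1..K. \<Sum>v=1..K. inverse (real (max u v))^2) \<le> (\<Sum>u=1..K. \<Sum>v=1..K. g u v + g v u)"
    by (intro sum_mono) (auto simp: g_def max_def)
  also have "\<dots> = 2 * harm K" unfolding sum.distrib h h' by simp
  finally show ?thesis .
qed

text \<open>Every solution of \<open>xy = zw\<close> has the form \<open>x = gu\<close>, \<open>z = gv\<close>, \<open>w = hu\<close>, \<open>y = hv\<close>.\<close>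

lemma card_mult_eq_mult:
  fixes K :: nat
  defines "T \<equiv> {(x, y, z, w). x \<in> {1..K} \<and> y \<in> {1..K} \<and> z \<in> {1..K} \<and> w \<in> {1..K} \<and> x * y = z * w}"
  shows "finite T" "real (card T) \<le> 2 * real K ^ 2 * harm K"
proof -
  \<comment> \<open>\<open>g\<close> and \<open>h\<close> range up to K / max(u, v) because all of
    gu, gv, hu, hv are at most K. Pairs u, v with a common factor are kept: an upper bound is
    wanted, and the sum over all pairs is simpler.\<close>
  define S where "S = (SIGMA (u, v):{1..K} \<times> {1..K}. {1..K div max u v} \<times> {1..K div max u v})"
  define \<phi> where "\<phi> = (\<lambda>((u, v), (g, h)). (g * u, h * v, g * v, h * u) :: nat \<times> nat \<times> nat \<times> nat)"
  have finS: "finite S" unfolding S_def by (intro finite_SigmaI) auto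
  have sub: "T \<subseteq> \<phi> ` S"
  proof (rule subsetI, clarify)
    fix x y z w assume "(x, y, z, w) \<in> T"
    then have b: "x \<in> {1..K}" "y \<in> {1..K}" "z \<in> {1..K}" "w \<in> {1..K}" "x * y = z * w"
      by (auto simp: T_def)
    define g where "g = gcd x z"
    have "x \<noteq> 0" using b by simp
    then have "g > 0" by (simp add: g_def)
    obtain u v where uv: "x = g * u" "z = g * v" "coprime u v"
      unfolding g_def using \<open>x \<noteq> 0\<close>
      by (metis gcd_coprime_exists gcd_eq_0_iff mult.commute)
    have "g * (u * y) = g * (v * w)" using b(5) uv by (simp add: ac_simps)
    then have uy: "u * y = v * w" using \<open>g > 0\<close> by simp
    then have "u dvd w" using uv(3) by (metis coprime_dvd_mult_right_iff dvd_triv_left)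
    then obtain h where h: "w = u * h" by blast
    have u: "u > 0" "v > 0" using b uv by (auto intro: Nat.gr0I)
    have "u * y = u * (v * h)" unfolding uy h by (rule mult.left_commute)
    then have y: "y = v * h" using u by simp
    have "h > 0" using b h by (auto intro: Nat.gr0I)
    have "u \<le> g * u" "v \<le> g * v" using \<open>g > 0\<close> by auto
    then have uK: "u \<le> K" "v \<le> K" using b(1,3) uv(1,2) by (meson atLeastAtMost_iff order_trans)+
    have "g * max u v \<le> K" "h * max u v \<le> K"
      using b unfolding uv(1,2) h y by (auto simp: max_def mult.commute)
    then have "g \<le> K div max u v" "h \<le> K div max u v"
      using u by (auto simp: less_eq_div_iff_mult_less_eq)
    then have "((u, v), (g, h)) \<in> S"
      unfolding S_def using u uK \<open>g > 0\<close> \<open>h > 0\<close> by auto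
    moreover have "(x, y, z, w) = \<phi> ((u, v), (g, h))"
      by (simp add: \<phi>_def uv h y mult.commute)
    ultimately show "(x, y, z, w) \<in> \<phi> ` S" by blast
  qed
  then show "finite T" using finS finite_subset by blast
  have "card T \<le> card S"
    using card_mono[OF finite_imageI[OF finS] sub] card_image_le[OF finS, of \<phi>] by linarith
  also have "card S = (\<Sum>(u, v)\<in>{1..K} \<times> {1..K}. (K div max u v)^2)"
    unfolding S_def by (subst card_SigmaI) (auto intro!: sum.cong simp: power2_eq_square)
  also have "\<dots> = (\<Sum>u=1..K. \<Sum>v=1..K. (K div max u v)^2)" by (simp add: sum.cartesian_product)
  finally have "real (card T) \<le> (\<Sum>u=1..K. \<Sum>v=1..K. real (K div max u v)^2)"
    by (metis (mono_tags, lifting) of_nat_le_iff of_nat_power of_nat_sum sum.cong)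
  also have "\<dots> \<le> (\<Sum>u=1..K. \<Sum>v=1..K. real K ^ 2 * inverse (real (max u v))^2)"
  proof (intro sum_mono)
    fix u v
    have "real (K div max u v) \<le> real K / real (max u v)" by (rule of_nat_div_le_of_nat)
    then have "real (K div max u v)^2 \<le> (real K / real (max u v))^2" by (intro power_mono) auto
    also have "\<dots> = real K ^ 2 * inverse (real (max u v))^2"
      by (simp only: divide_inverse power_mult_distrib)
    finally show "real (K div max u v)^2 \<le> real K ^ 2 * inverse (real (max u v))^2" .
  qed
  also have "\<dots> = real K ^ 2 * (\<Sum>u=1..K. \<Sum>v=1..K. inverse (real (max u v))^2)"
    by (simp add: sum_distrib_left)
  also have "\<dots> \<le> real K ^ 2 * (2 * harm K)"
    by (intro mult_left_mono sum_inverse_max_square) auto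
  finally show "real (card T) \<le> 2 * real K ^ 2 * harm K" by simp
qed

text \<open>A coincidence of values reads (u - u')(u + u') = 2(v' - v)(v' + v), an instance of xy =
  zw with factors at most 4M. The diagonal contributes M^2, and the two off-diagonal halves 2 * 2
  (4M)^2 (1 + ln (4M)), whence 65 and 64.\<close>

lemma card_norm_collisions:
  fixes M :: nat
  assumes "M > 0"
  defines "E \<equiv> {(a, b). a \<in> {1..M} \<times> {1..M} \<and> b \<in> {1..M} \<times> {1..M} \<and>
     (case a of (u, v) \<Rightarrow> u\<^sup>2 + 2 * v\<^sup>2) = (case b of (u, v) \<Rightarrow> u\<^sup>2 + 2 * v\<^sup>2)}"
  shows "finite E" "real (card E) \<le> real M ^ 2 * (65 + 64 * ln (4 * real M))"
proof -
  define P where "P = {1..M} \<times> {1..M}"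
  define K where "K = 4 * M"
  define T where "T = {(x, y, z, w). x \<in> {1..K} \<and> y \<in> {1..K} \<and> z \<in> {1..K} \<and> w \<in> {1..K} \<and> x * y = z * w}"
  \<comment> \<open>In this half u' < u and therefore v < v', so the subtractions on naturals in
    \<psi> do not truncate.\<close>
  define E1 where "E1 = {(a, b) \<in> E. fst b < fst a}"
  define \<psi> where "\<psi> = (\<lambda>((u, v), (u', v')). (u - u', u + u', 2 * (v' - v), v' + v) :: nat \<times> nat \<times> nat \<times> nat)"
  have finP: "finite P" by (simp add: P_def)
  have "E \<subseteq> P \<times> P" by (auto simp: E_def P_def)
  then show finE: "finite E" using finP finite_subset finite_cartesian_product by metis
  have E1D: "v < v'" "(u - u') * (u + u') = (2 * (v' - v)) * (v' + v)"
    if "((u, v), (u', v')) \<in> E1" for u v u' v'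
  proof -
    have *: "u' < u" "u\<^sup>2 + 2 * v\<^sup>2 = u'\<^sup>2 + 2 * v'\<^sup>2" using that by (auto simp: E1_def E_def)
    have "u'\<^sup>2 < u\<^sup>2" using *(1) by (simp add: power_strict_mono)
    then have "v\<^sup>2 < v'\<^sup>2" using *(2) by linarith
    then show "v < v'" by (rule power_less_imp_less_base) simp
    from *(1) obtain d where d: "u = u' + d" using less_imp_add_positive by blast
    from \<open>v < v'\<close> obtain e where e: "v' = v + e" using less_imp_add_positive by blast
    show "(u - u') * (u + u') = (2 * (v' - v)) * (v' + v)"
      using *(2) unfolding d e by (simp add: power2_eq_square algebra_simps)
  qed
  have "inj_on \<psi> E1"
  proof (rule inj_onI)
    fix a b assume ab: "a \<in> E1" "b \<in> E1" "\<psi> a = \<psi> b"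
    obtain u v u' v' where a: "a = ((u, v), (u', v'))" by (cases a) auto
    obtain p q p' q' where b: "b = ((p, q), (p', q'))" by (cases b) auto
    note * = ab[unfolded a b]
    have "u' < u" "p' < p" using * by (auto simp: E1_def)
    moreover have "u - u' = p - p'" "u + u' = p + p'" "v' - v = q' - q" "v' + v = q' + q"
      using *(3) by (auto simp: \<psi>_def)
    moreover note E1D(1)[OF *(1)] E1D(1)[OF *(2)]
    ultimately have "u = p" "u' = p'" "v = q" "v' = q'" by linarith+
    then show "a = b" by (simp add: a b)
  qed
  moreover have "\<psi> ` E1 \<subseteq> T"
  proof (rule image_subsetI)
    fix a assume "a \<in> E1"
    then obtain u v u' v' where a: "a = ((u, v), (u', v'))" and *: "((u, v), (u', v')) \<in> E1"
      by (cases a) auto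
    have "u \<in> {1..M}" "v \<in> {1..M}" "u' \<in> {1..M}" "v' \<in> {1..M}" "u' < u"
      using * by (auto simp: E1_def E_def)
    with E1D[OF *] show "\<psi> a \<in> T"
      by (auto simp: a \<psi>_def T_def K_def)
  qed
  ultimately have "card E1 \<le> card T"
    using card_inj_on_le card_mult_eq_mult(1)[of K] unfolding T_def by blast
  then have cE1: "real (card E1) \<le> 2 * real K ^ 2 * harm K"
    using card_mult_eq_mult(2)[of K] unfolding T_def[symmetric] by linarith
  have sub: "E \<subseteq> (\<lambda>a. (a, a)) ` P \<union> (E1 \<union> prod.swap ` E1)"
  proof (rule subsetI, clarify)
    fix u v u' v' assume *: "((u, v), (u', v')) \<in> E"
      "((u, v), (u', v')) \<notin> (\<lambda>a. (a, a)) ` P" "((u, v), (u', v')) \<notin> prod.swap ` E1"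
    have sw: "((u', v'), (u, v)) \<in> E" using *(1) by (auto simp: E_def)
    have "\<not> u < u'"
    proof
      assume "u < u'"
      then have "((u', v'), (u, v)) \<in> E1" using sw by (simp add: E1_def)
      then show False using *(3) by (metis image_eqI swap_simp)
    qed
    moreover have "u \<noteq> u'"
    proof
      assume "u = u'"
      moreover from this have "v\<^sup>2 = v'\<^sup>2" using *(1) by (auto simp: E_def)
      then have "v = v'" by simp
      ultimately show False using *(1,2) by (auto simp: E_def P_def)
    qed
    ultimately show "((u, v), (u', v')) \<in> E1" using *(1) by (simp add: E1_def)
  qed
  have finE1: "finite E1" using finE by (rule finite_subset[rotated]) (auto simp: E1_def)
  have "card E \<le> card ((\<lambda>a. (a, a)) ` P \<union> (E1 \<union> prod.swap ` E1))"
    using sub finP finE1 by (intro card_mono) auto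
  also have "\<dots> \<le> card ((\<lambda>a. (a, a)) ` P) + (card E1 + card (prod.swap ` E1))"
    by (meson add_left_mono card_Un_le order_trans)
  also have "\<dots> \<le> card P + (card E1 + card E1)"
    by (intro add_mono card_image_le finP finE1 order_refl)
  also have "card P = M ^ 2" by (simp add: P_def power2_eq_square)
  finally have "real (card E) \<le> real M ^ 2 + 2 * real (card E1)"
    by (metis (no_types, lifting) mult_2 of_nat_add of_nat_le_iff of_nat_power)
  also have "\<dots> \<le> real M ^ 2 + 2 * (2 * real K ^ 2 * (1 + ln (real K)))"
  proof -
    have "2 * real K ^ 2 * harm K \<le> 2 * real K ^ 2 * (1 + ln (real K))"
      using harm_le_ln[of K] assms(1) by (intro mult_left_mono) (auto simp: K_def)
    with cE1 show ?thesis by linarith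
  qed
  also have "\<dots> = real M ^ 2 * (65 + 64 * ln (4 * real M))"
    by (simp add: K_def power2_eq_square algebra_simps)
  finally show "real (card E) \<le> real M ^ 2 * (65 + 64 * ln (4 * real M))" .
qed

text \<open>The fibre sizes sum to the size of \<open>S\<close>, and their squares sum to the number
  of coinciding pairs.\<close>

lemma card_image_Cauchy_Schwarz:
  assumes "finite S"
  shows "(real (card S))\<^sup>2 \<le> real (card (F ` S)) * real (card {(a, b). a \<in> S \<and> b \<in> S \<and> F a = F b})"
proof -
  define n where "n = (\<lambda>y. card {a \<in> S. F a = y})"
  have "card S = (\<Sum>y\<in>F ` S. n y)"
    using sum.image_gen[OF assms, of "\<lambda>_. 1 :: nat" F] by (simp add: n_def)
  then have "(real (card S))\<^sup>2 = (\<Sum>y\<in>F ` S. real (n y))\<^sup>2" by simp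
  also have "\<dots> \<le> (\<Sum>y\<in>F ` S. (real (n y))\<^sup>2) * real (card (F ` S))"
    by (rule sum_squared_le_sum_of_squares)
  also have "(\<Sum>y\<in>F ` S. (real (n y))\<^sup>2) = real (card {(a, b). a \<in> S \<and> b \<in> S \<and> F a = F b})"
  proof -
    have "{(a, b). a \<in> S \<and> b \<in> S \<and> F a = F b} = (\<Union>y\<in>F ` S. {a \<in> S. F a = y} \<times> {a \<in> S. F a = y})"
      by auto
    also have "card \<dots> = (\<Sum>y\<in>F ` S. card ({a \<in> S. F a = y} \<times> {a \<in> S. F a = y}))"
      by (rule card_UN_disjoint) (use assms in auto)
    finally show ?thesis by (simp add: n_def power2_eq_square card_cartesian_product)
  qed
  finally show ?thesis by (simp add: mult.commute)
qed

subsection \<open>Coprime points on a conic modulo \<open>p\<close>\<close>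

text \<open>Pigeonhole: for 0 \<le> u, v \<le> (p - 1)/2 the squares u^2 and the numbers r - 2 v^2
  each take (p + 1)/2 residues, together more than p, so the two sets meet.\<close>

lemma conic_solvable_mod_prime:
  fixes p :: nat and r :: int
  assumes p: "prime p" "odd p"
  obtains u v :: int where "[u\<^sup>2 + 2 * v\<^sup>2 = r] (mod int p)"
proof -
  define h where "h = (int p - 1) div 2"
  have h: "2 * h + 1 = int p" "h \<ge> 0"
    using p prime_gt_0_nat[OF p(1)] by (auto simp: h_def)
  have pp: "prime (int p)" using p by simp
  have sq: "u = u'" if "[u\<^sup>2 = u'\<^sup>2] (mod int p)" "u \<in> {0..h}" "u' \<in> {0..h}" for u u'
  proof -
    have "int p dvd u\<^sup>2 - u'\<^sup>2" using that(1) by (simp add: cong_iff_dvd_diff)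
    also have "u\<^sup>2 - u'\<^sup>2 = (u - u') * (u + u')" by (simp add: power2_eq_square algebra_simps)
    finally have "int p dvd u - u' \<or> int p dvd u + u'" using pp by (simp add: prime_dvd_mult_iff)
    then have "u - u' = 0 \<or> u + u' = 0"
      using that(2,3) h zdvd_imp_le[of "int p" "\<bar>u - u'\<bar>"] zdvd_imp_le[of "int p" "u + u'"] by fastforce
    then show ?thesis using that(2,3) by auto
  qed
  define A where "A = (\<lambda>u. u\<^sup>2 mod int p) ` {0..h}"
  define B where "B = (\<lambda>v. (r - 2 * v\<^sup>2) mod int p) ` {0..h}"
  have cA: "card A = nat (h + 1)"
    unfolding A_def by (subst card_image) (auto intro!: inj_onI sq simp: unique_euclidean_semiring_class.cong_def)
  have "inj_on (\<lambda>v. (r - 2 * v\<^sup>2) mod int p) {0..h}"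
  proof (rule inj_onI)
    fix v v' assume *: "v \<in> {0..h}" "v' \<in> {0..h}" "(r - 2 * v\<^sup>2) mod int p = (r - 2 * v'\<^sup>2) mod int p"
    then have "[r - 2 * v\<^sup>2 = r - 2 * v'\<^sup>2] (mod int p)" by (simp add: unique_euclidean_semiring_class.cong_def)
    then have "[2 * v'\<^sup>2 = 2 * v\<^sup>2] (mod int p)" by (simp add: cong_iff_dvd_diff)
    then have "[2 * v\<^sup>2 = 2 * v'\<^sup>2] (mod int p)" by (rule cong_sym)
    moreover have "coprime 2 (int p)" using p(2) by simp
    ultimately have "[v\<^sup>2 = v'\<^sup>2] (mod int p)" by (metis cong_mult_lcancel)
    then show "v = v'" using sq * by blast
  qed
  then have cB: "card B = nat (h + 1)" unfolding B_def by (subst card_image) auto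
  have "A \<inter> B \<noteq> {}"
  proof
    assume disj: "A \<inter> B = {}"
    have sub: "A \<union> B \<subseteq> {0..<int p}"
      using h by (auto simp: A_def B_def)
    have fin: "finite A" "finite B" by (auto simp: A_def B_def)
    have "card (A \<union> B) \<le> card {0..<int p}" by (rule card_mono) (use sub in auto)
    then have "nat (h + 1) + nat (h + 1) \<le> p" using card_Un_disjoint[OF fin disj] cA cB by simp
    then show False using h by linarith
  qed
  then obtain u v where "u\<^sup>2 mod int p = (r - 2 * v\<^sup>2) mod int p" by (auto simp: A_def B_def)
  then have "[u\<^sup>2 = r - 2 * v\<^sup>2] (mod int p)" by (simp add: unique_euclidean_semiring_class.cong_def)
  then have "[u\<^sup>2 + 2 * v\<^sup>2 = r - 2 * v\<^sup>2 + 2 * v\<^sup>2] (mod int p)" by (intro cong_add cong_refl)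
  then show ?thesis using that by simp
qed

text \<open>Adding the odd number p repairs the parity of U, and adding it to V makes V positive.
  Odd U keeps all values on the progressions below odd; the bounds 2p keep the points in a box of
  side 2pN.\<close>

lemma conic_point_odd:
  fixes p :: nat and r :: int
  assumes p: "prime p" "odd p"
  obtains U V :: nat where "odd U" "0 < U" "U \<le> 2 * p" "0 < V" "V \<le> 2 * p"
    "[int (U\<^sup>2 + 2 * V\<^sup>2) = r] (mod int p)"
proof -
  obtain u v :: int where uv: "[u\<^sup>2 + 2 * v\<^sup>2 = r] (mod int p)"
    using conic_solvable_mod_prime[OF p] .
  have p0: "p > 0" using p prime_gt_0_nat by blast
  define u' v' where "u' = nat (u mod int p)" and "v' = nat (v mod int p)"
  have iu: "int u' = u mod int p" "int v' = v mod int p" using p0 by (auto simp: u'_def v'_def)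
  have "u mod int p < int p" "v mod int p < int p" using p0 by auto
  then have lt: "u' < p" "v' < p" unfolding iu[symmetric] by auto
  define U where "U = (if odd u' then u' else u' + p)"
  define V where "V = v' + p"
  have "odd U" using p(2) by (auto simp: U_def)
  moreover from this have "U > 0" by (rule odd_pos)
  moreover have "U \<le> 2 * p" using lt by (auto simp: U_def)
  moreover have "V > 0" "V \<le> 2 * p" using p0 lt by (auto simp: V_def)
  moreover have "[int (U\<^sup>2 + 2 * V\<^sup>2) = r] (mod int p)"
  proof -
    have "[int U = u] (mod int p)" "[int V = v] (mod int p)"
      using iu by (auto simp: U_def V_def unique_euclidean_semiring_class.cong_def)
    then have "[(int U)\<^sup>2 + 2 * (int V)\<^sup>2 = u\<^sup>2 + 2 * v\<^sup>2] (mod int p)"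
      by (intro cong_add cong_mult cong_pow cong_refl)
    then show ?thesis using uv by (simp add: cong_trans)
  qed
  ultimately show ?thesis using that by blast
qed

section \<open>A crude sieve for coprime pairs in arithmetic progressions\<close>

text \<open>Divisibility fixes i modulo q, so i is determined by i div q.\<close>

lemma card_dvd_arith_progression_le:
  fixes a d q N :: nat
  assumes "coprime q d" "q > 0"
  shows "card {i. i < N \<and> q dvd a + d * i} \<le> N div q + 1"
proof -
  let ?I = "{i. i < N \<and> q dvd a + d * i}"
  have "inj_on (\<lambda>i. i div q) ?I"
  proof (rule inj_onI)
    fix i i' assume *: "i \<in> ?I" "i' \<in> ?I" "i div q = i' div q"
    have "[a + d * i = a + d * i'] (mod q)" using * by (simp add: unique_euclidean_semiring_class.cong_def dvd_eq_mod_eq_0)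
    then have "[d * i = d * i'] (mod q)" by (simp add: cong_add_lcancel_nat)
    then have "[i = i'] (mod q)" using assms(1) by (simp add: cong_mult_lcancel_nat coprime_commute)
    then have "i mod q = i' mod q" by (simp add: unique_euclidean_semiring_class.cong_def)
    with *(3) show "i = i'" by (metis div_mult_mod_eq)
  qed
  moreover have "(\<lambda>i. i div q) ` ?I \<subseteq> {0..N div q}" by (auto intro!: div_le_mono)
  ultimately have "card ?I \<le> card {0..N div q}" by (intro card_inj_on_le) auto
  then show ?thesis by simp
qed

text \<open>(2m + 1)^2 > 4m(m + 1), and the reciprocals of the latter telescope. The telescoped
  remainder is kept in the inequality proved by induction.\<close>

lemma sum_inverse_odd_squares: "(\<Sum>m=1..K. 1 / (real (2 * m + 1))\<^sup>2) \<le> 1 / 4"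
proof -
  have "(\<Sum>m=1..K. 1 / (real (2 * m + 1))\<^sup>2) \<le> 1 / 4 - 1 / (4 * (real K + 1))"
  proof (induction K)
    case (Suc K)
    have "1 / (real (2 * Suc K + 1))\<^sup>2 \<le> 1 / (4 * (real K + 1)) - 1 / (4 * (real (Suc K) + 1))"
    proof -
      have "1 / (4 * (real K + 1)) - 1 / (4 * (real (Suc K) + 1)) = 1 / (4 * (real K + 1) * (real K + 2))"
        by (simp add: divide_simps)
      moreover have "1 / (real (2 * Suc K + 1))\<^sup>2 \<le> 1 / (4 * (real K + 1) * (real K + 2))"
        by (rule frac_le) (simp, simp, simp, simp add: power2_eq_square algebra_simps)
      ultimately show ?thesis by simp
    qed
    with Suc.IH show ?case by simp
  qed auto
  also have "\<dots> \<le> 1 / 4" by simp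
  finally show ?thesis .
qed

text \<open>A common prime factor q is odd since U + 2pi is odd, differs from p by
  \<open>cop\<close>, and is at most 2pN. For each such q at most (N/q + 1)^2 pairs are lost, and
  the main terms add up to at most N^2 / 4, because the moduli start at 3.\<close>

lemma card_coprime_pairs_ge:
  fixes p U V N :: nat
  assumes p: "prime p" "odd U" "U \<le> 2 * p" and cop: "\<not> p dvd U\<^sup>2 + 2 * V\<^sup>2" and N: "N > 0"
  shows "real (card {(i, j). i < N \<and> j < N \<and> coprime (U + 2 * p * i) (V + p * j)})
     \<ge> 3 / 4 * real N ^ 2 - real N * harm (p * N) - real (p * N)"
proof -
  define G where "G = {(i, j). i < N \<and> j < N \<and> coprime (U + 2 * p * i) (V + p * j)}"
  define I where "I = (\<lambda>q. {i. i < N \<and> q dvd U + (2 * p) * i})"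
  define J where "J = (\<lambda>q. {j. j < N \<and> q dvd V + p * j})"
  \<comment> \<open>The union runs over all odd moduli 2m + 1 coprime to p, not only over primes, so
    that no sums over primes arise.\<close>
  define Ms where "Ms = {m \<in> {1..p * N}. coprime (2 * m + 1) p}"
  define Bad where "Bad = (\<Union>m\<in>Ms. I (2 * m + 1) \<times> J (2 * m + 1))"
  have sub: "{..<N} \<times> {..<N} \<subseteq> G \<union> Bad"
  proof (rule subsetI, clarify)
    fix i j assume ij: "i < N" "j < N" "(i, j) \<notin> Bad"
    have "coprime (U + 2 * p * i) (V + p * j)"
    proof (rule ccontr)
      assume "\<not> coprime (U + 2 * p * i) (V + p * j)"
      then have "gcd (U + 2 * p * i) (V + p * j) \<noteq> 1" by (simp add: coprime_iff_gcd_eq_1)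
      from prime_factor_nat[OF this] obtain q where q: "prime q" "q dvd U + 2 * p * i" "q dvd V + p * j"
        by auto
      have "odd (U + 2 * p * i)" using p(2) by simp
      then have "odd q" using q(2) dvd_trans by blast
      then obtain m where m: "q = 2 * m + 1" by (elim oddE)
      have "q \<noteq> p"
      proof
        assume "q = p"
        then have "p dvd U + p * (2 * i)" "p dvd V + p * j" using q by (auto simp: ac_simps)
        then have "p dvd U" "p dvd V" by (simp_all add: dvd_add_left_iff)
        then have "p dvd U\<^sup>2 + 2 * V\<^sup>2" by (simp add: power2_eq_square)
        then show False using cop by simp
      qed
      then have cqp: "coprime q p" using q(1) p(1) by (simp add: primes_coprime)
      have "m \<noteq> 0" using m q(1) by (intro notI) auto
      have "q \<le> U + 2 * p * i" using q(2) by (rule dvd_imp_le) (use p(2) in \<open>auto intro: odd_pos\<close>)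
      also have "\<dots> \<le> 2 * p + 2 * p * i" using p(3) by simp
      also have "\<dots> = 2 * p * (i + 1)" by simp
      also have "\<dots> \<le> 2 * p * N" using ij(1) by (intro mult_left_mono) auto
      finally have "m \<le> p * N" using m by simp
      then have "m \<in> Ms" using \<open>m \<noteq> 0\<close> cqp m by (auto simp: Ms_def)
      moreover have "(i, j) \<in> I q \<times> J q" using ij q by (auto simp: I_def J_def)
      ultimately show False using ij(3) unfolding Bad_def m by blast
    qed
    then show "(i, j) \<in> G" using ij by (simp add: G_def)
  qed
  have finG: "finite G" by (rule finite_subset[of _ "{..<N} \<times> {..<N}"]) (auto simp: G_def)
  have finM: "finite Ms" by (simp add: Ms_def)
  have finIJ: "finite (I q \<times> J q)" for q by (auto simp: I_def J_def)
  have finB: "finite Bad" unfolding Bad_def using finM finIJ by blast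
  have each: "real (card (I (2 * m + 1) \<times> J (2 * m + 1))) \<le>
      real N ^ 2 * (1 / (real (2 * m + 1))\<^sup>2) + real N * inverse (real m) + 1" if m: "m \<in> Ms" for m
  proof -
    define q where "q = 2 * m + 1"
    have cq: "coprime q (2 * p)" "coprime q p" and "m \<ge> 1" using m by (auto simp: Ms_def q_def)
    have q0: "q > 0" by (simp add: q_def)
    have "real (card (I q)) \<le> real (N div q) + 1" "real (card (J q)) \<le> real (N div q) + 1"
      using card_dvd_arith_progression_le[OF cq(1) q0, of N U] card_dvd_arith_progression_le[OF cq(2) q0, of N V]
      unfolding I_def J_def by linarith+
    moreover have "real (N div q) \<le> real N / real q" by (rule of_nat_div_le_of_nat)
    ultimately have "real (card (I q)) \<le> real N / real q + 1" "real (card (J q)) \<le> real N / real q + 1"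
      by linarith+
    then have "real (card (I q)) * real (card (J q)) \<le> (real N / real q + 1) * (real N / real q + 1)"
      by (intro mult_mono) auto
    also have "\<dots> = real N ^ 2 * (1 / (real q)\<^sup>2) + real N * (2 / real q) + 1"
      by (simp add: power2_eq_square add_divide_distrib algebra_simps)
    also have "real N * (2 / real q) \<le> real N * inverse (real m)"
      using \<open>m \<ge> 1\<close> by (intro mult_left_mono) (auto simp: q_def field_simps)
    finally show ?thesis by (simp add: card_cartesian_product q_def)
  qed
  have "real (card Bad) \<le> (\<Sum>m\<in>Ms. real (card (I (2 * m + 1) \<times> J (2 * m + 1))))"
    unfolding Bad_def of_nat_sum[symmetric] of_nat_le_iff using finM by (rule card_UN_le)
  also have "\<dots> \<le> (\<Sum>m\<in>Ms. real N ^ 2 * (1 / (real (2 * m + 1))\<^sup>2) + real N * inverse (real m) + 1)"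
    by (intro sum_mono each)
  also have "\<dots> \<le> (\<Sum>m=1..p*N. real N ^ 2 * (1 / (real (2 * m + 1))\<^sup>2) + real N * inverse (real m) + 1)"
    by (intro sum_mono2) (auto simp: Ms_def)
  also have "\<dots> = real N ^ 2 * (\<Sum>m=1..p*N. 1 / (real (2 * m + 1))\<^sup>2) + real N * harm (p * N) + real (p * N)"
    by (simp add: sum.distrib sum_distrib_left harm_def)
  also have "\<dots> \<le> real N ^ 2 * (1 / 4) + real N * harm (p * N) + real (p * N)"
    by (intro add_mono mult_left_mono sum_inverse_odd_squares) auto
  finally have B: "real (card Bad) \<le> real N ^ 2 * (1 / 4) + real N * harm (p * N) + real (p * N)" .
  have "card ({..<N} \<times> {..<N}) \<le> card G + card Bad"
    using card_mono[OF _ sub] finG finB card_Un_le[of G Bad] by (meson finite_UnI order_trans)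
  then have "real N ^ 2 \<le> real (card G) + real (card Bad)"
    by (simp add: power2_eq_square card_cartesian_product flip: of_nat_add of_nat_mult)
  with B show ?thesis unfolding G_def[symmetric] by linarith
qed

text \<open>The error terms are of order N log N and eventually fit into N^2 / 4, the gap between
  3/4 and 1/2.\<close>

lemma eventually_card_coprime_pairs_ge:
  fixes p U V :: nat
  assumes p: "prime p" "odd U" "U \<le> 2 * p" and cop: "\<not> p dvd U\<^sup>2 + 2 * V\<^sup>2"
  shows "eventually (\<lambda>N. real (card {(i, j). i < N \<and> j < N \<and> coprime (U + 2 * p * i) (V + p * j)})
     \<ge> real N ^ 2 / 2) sequentially"
proof -
  have "real p > 0" using p(1) prime_gt_0_nat by simp
  then have "eventually (\<lambda>N. real N * (1 + ln (real p * real N)) + real p * real N \<le> real N ^ 2 / 4) sequentially"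
    by real_asymp
  then show ?thesis using eventually_gt_at_top[of 0]
  proof eventually_elim
    case (elim N)
    have "p * N > 0" using elim(2) p(1) prime_gt_0_nat by simp
    then have "real N * harm (p * N) \<le> real N * (1 + ln (real p * real N))"
      using harm_le_ln[of "p * N"] by (intro mult_left_mono) auto
    then show ?case
      using card_coprime_pairs_ge[OF p cop elim(2)] elim(1) by simp
  qed
qed

subsection \<open>Counting discriminants\<close>

text \<open>A form of discriminant -n would give a square b^2 congruent to 3 modulo 4.\<close>

lemma hurwitz_class_number_eq_0:
  assumes "n mod 4 = 1"
  shows "hurwitz_class_number (- int n) = 0"
proof -
  have "pos_def_forms (- int n) = {}"
  proof (rule ccontr)
    assume "pos_def_forms (- int n) \<noteq> {}"
    then obtain a b c where "bqf_disc (a, b, c) = - int n"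
      unfolding pos_def_forms_def by fastforce
    then have "b\<^sup>2 + int n = 4 * (a * c)" by (simp add: bqf_disc_def)
    then have "(b\<^sup>2 + int n) mod 4 = 0" by simp
    moreover have "int n mod 4 = 1" using assms by (metis of_nat_1 of_nat_mod of_nat_numeral)
    moreover have "b\<^sup>2 mod 4 = 0 \<or> b\<^sup>2 mod 4 = 1"
    proof (cases "even b")
      case True
      then obtain k where "b = 2 * k" by blast
      then show ?thesis by (simp add: power_mult_distrib)
    next
      case False
      then obtain k where "b = 2 * k + 1" by (elim oddE)
      then have "b\<^sup>2 = 4 * (k\<^sup>2 + k) + 1" by (simp add: power2_eq_square algebra_simps)
      then have "b\<^sup>2 mod 4 = 1" by presburger
      then show ?thesis ..
    qed
    ultimately show False by presburger
  qed
  then show ?thesis by (simp add: hurwitz_class_number_def)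
qed

lemma p_integral_of_int: "prime p \<Longrightarrow> p_integral p (of_int k)"
  by (auto simp: p_integral_def)

lemma p_integral_cong_of_int:
  assumes "prime p" "[a = b] (mod int p)"
  shows "p_integral_cong p (of_int a) (of_int b)"
proof -
  from assms(2) obtain k where "a - b = int p * k" by (auto simp: cong_iff_dvd_diff)
  then have "rat_of_int a - rat_of_int b = of_nat p * of_int k"
    by (metis of_int_diff of_int_mult of_int_of_nat_eq)
  then show ?thesis
    unfolding p_integral_cong_def using p_integral_of_int[OF assms(1)] by blast
qed

text \<open>Modulo f = u^2 + 2 v^2 the number v is invertible, as it is coprime to u, and (u / v)^2
  = -2.\<close>

lemma exists_sqrt_minus_2:
  fixes u v :: nat
  assumes "coprime u v"
  obtains s :: int where "int (u\<^sup>2 + 2 * v\<^sup>2) dvd s\<^sup>2 + 2"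
proof -
  define f where "f = int u ^ 2 + 2 * int v ^ 2"
  have "coprime (int v) (int u ^ 2)" using assms by (simp add: coprime_commute)
  then have "coprime (int v) f"
    unfolding f_def coprime_iff_gcd_eq_1
    by (metis gcd_add_mult mult.assoc power2_eq_square mult.left_commute add.commute)
  then obtain w where w: "[int v * w = 1] (mod f)" using cong_solve_coprime_int by blast
  have "(int u * w)\<^sup>2 + 2 = f * w\<^sup>2 + 2 * (1 - (int v * w)\<^sup>2)"
    by (simp add: f_def power2_eq_square algebra_simps)
  also have "[\<dots> = 0 * w\<^sup>2 + 2 * (1 - 1\<^sup>2)] (mod f)"
    by (intro cong_add cong_mult cong_diff cong_pow w cong_refl) (simp add: cong_0_iff)
  finally have "f dvd (int u * w)\<^sup>2 + 2" by (simp add: cong_0_iff)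
  then show ?thesis using that[of "int u * w"] by (simp add: f_def)
qed

lemma finite_bounded_nats: "finite {n :: nat. 1 \<le> n \<and> real n \<le> X \<and> P n}"
  by (rule finite_subset[of _ "{0..nat \<lfloor>X\<rfloor>}"]) (auto simp: le_nat_floor)

text \<open>With M = 2pN, values satisfy f \<le> 3 M^2, so n = 8 f^2 \<le> 8 (12 p^2 N^2)^2, giving
  1152. The left side is (N^2 / 2)^2 divided by the collision bound M^2 (65 + 64 ln (4M)).\<close>

lemma eventually_count_ge:
  fixes p :: nat and r :: int
  assumes p: "prime p" "odd p" and r: "[r \<noteq> 0] (mod int p)"
  shows "eventually (\<lambda>N. real N ^ 2 / (16 * real p ^ 2 * (65 + 64 * ln (8 * real p * real N))) \<le>
     real (card {n::nat. 1 \<le> n \<and> real n \<le> 1152 * real p ^ 4 * real N ^ 4 \<and>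
             p_integral_cong p (hurwitz_class_number (- int n)) (of_int r)})) sequentially"
proof -
  have p0: "p > 0" using p prime_gt_0_nat by blast
  obtain U V :: nat where UV: "odd U" "0 < U" "U \<le> 2 * p" "0 < V" "V \<le> 2 * p"
    "[int (U\<^sup>2 + 2 * V\<^sup>2) = r] (mod int p)"
    using conic_point_odd[OF p] .
  have ndvd: "\<not> p dvd U\<^sup>2 + 2 * V\<^sup>2"
  proof
    assume "p dvd U\<^sup>2 + 2 * V\<^sup>2"
    then have "int p dvd int (U\<^sup>2 + 2 * V\<^sup>2)" by (simp only: of_nat_dvd_iff)
    then have "int p dvd r" using UV(6) by (simp add: cong_dvd_iff)
    then show False using r by (simp add: cong_0_iff)
  qed
  show ?thesis
    using eventually_card_coprime_pairs_ge[OF p(1) UV(1,3) ndvd] eventually_gt_at_top[of 0]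
  proof eventually_elim
    case (elim N)
    define I where "I = {(i, j). i < N \<and> j < N \<and> coprime (U + 2 * p * i) (V + p * j)}"
    \<comment> \<open>Step 2p in the first coordinate keeps u odd; both steps preserve the point of
      the conic modulo p.\<close>
    define pt where "pt = (\<lambda>(i, j). (U + 2 * p * i, V + p * j))"
    define S where "S = pt ` I"
    define F where "F = (\<lambda>(u::nat, v::nat). u\<^sup>2 + 2 * v\<^sup>2)"
    define M where "M = 2 * p * N"
    define E where "E = {(a, b). a \<in> {1..M} \<times> {1..M} \<and> b \<in> {1..M} \<times> {1..M} \<and> F a = F b}"
    define C where "C = {n::nat. 1 \<le> n \<and> real n \<le> 1152 * real p ^ 4 * real N ^ 4 \<and>
             p_integral_cong p (hurwitz_class_number (- int n)) (of_int r)}"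
    define L where "L = 65 + 64 * ln (8 * real p * real N)"
    have L_eq: "L = 65 + 64 * ln (4 * real M)" by (simp add: L_def M_def mult.assoc)
    have "M > 0" using p0 elim(2) by (simp add: M_def)
    have finI: "finite I" by (rule finite_subset[of _ "{..<N} \<times> {..<N}"]) (auto simp: I_def)
    have "inj_on pt I" using p0 by (auto simp: pt_def intro!: inj_onI)
    then have cS: "card S = card I" unfolding S_def by (rule card_image)
    have finS: "finite S" using finI by (simp add: S_def)
    have S: "coprime u v" "odd u" "u \<in> {1..M}" "v \<in> {1..M}" "[int (u\<^sup>2 + 2 * v\<^sup>2) = r] (mod int p)"
      if "(u, v) \<in> S" for u v
    proof -
      from that obtain i j where ij: "i < N" "j < N" "coprime u v" "u = U + 2 * p * i" "v = V + p * j"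
        by (auto simp: S_def pt_def I_def)
      show "coprime u v" by fact
      show "odd u" using UV(1) ij by simp
      have "u \<le> 2 * p * (i + 1)" using UV(3) ij(4) by simp
      also have "\<dots> \<le> M" unfolding M_def using ij(1) by (intro mult_left_mono) auto
      finally show "u \<in> {1..M}" using UV(2) ij(4) by simp
      have "v \<le> 2 * p * (j + 1)" using UV(5) ij(5) by simp
      also have "\<dots> \<le> M" unfolding M_def using ij(2) by (intro mult_left_mono) auto
      finally show "v \<in> {1..M}" using UV(4) ij(5) by simp
      have "[int u = int U] (mod int p)" "[int v = int V] (mod int p)"
        using ij(4,5) by (auto simp: cong_iff_dvd_diff)
      then have "[(int u)\<^sup>2 + 2 * (int v)\<^sup>2 = (int U)\<^sup>2 + 2 * (int V)\<^sup>2] (mod int p)"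
        by (intro cong_add cong_mult cong_pow cong_refl)
      then show "[int (u\<^sup>2 + 2 * v\<^sup>2) = r] (mod int p)" using UV(6) by (simp add: cong_trans)
    qed
    have sub: "(\<lambda>f. 8 * f\<^sup>2) ` F ` S \<subseteq> C"
    proof (rule subsetI, elim imageE)
      fix n f a assume n: "n = 8 * f\<^sup>2" "f = F a" "a \<in> S"
      obtain u v where a: "a = (u, v)" by (cases a)
      note uv = S[OF n(3)[unfolded a]]
      have f: "f = u\<^sup>2 + 2 * v\<^sup>2" by (simp add: n a F_def)
      obtain s where "int f dvd s\<^sup>2 + 2" using exists_sqrt_minus_2[OF uv(1)] f by blast
      moreover have "odd f" using uv(2) by (simp add: f)
      ultimately have "hurwitz_class_number (- int n) = of_int (int f)"
        unfolding n(1) by (subst hurwitz_class_number_8_square) auto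
      then have cong: "p_integral_cong p (hurwitz_class_number (- int n)) (of_int r)"
        using p_integral_cong_of_int[OF p(1), of "int f" r] uv(5) f by simp
      have "u\<^sup>2 \<le> M\<^sup>2" "v\<^sup>2 \<le> M\<^sup>2" using uv(3,4) by (auto intro: power_mono)
      then have "f \<le> 3 * M\<^sup>2" unfolding f by linarith
      then have "8 * f\<^sup>2 \<le> 8 * (3 * M\<^sup>2)\<^sup>2" by (intro mult_left_mono power_mono) auto
      also have "\<dots> = 1152 * p ^ 4 * N ^ 4" by (simp add: M_def power_mult_distrib flip: power_mult)
      finally have "real n \<le> real (1152 * p ^ 4 * N ^ 4)" unfolding n(1) of_nat_le_iff .
      moreover have "n \<ge> 1" using \<open>odd f\<close> by (simp add: n(1) odd_pos Suc_le_eq)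
      ultimately show "n \<in> C" using cong by (simp add: C_def)
    qed
    have "inj_on (\<lambda>f::nat. 8 * f\<^sup>2) (F ` S)" by (auto intro!: inj_onI)
    then have "card (F ` S) = card ((\<lambda>f. 8 * f\<^sup>2) ` F ` S)" by (simp add: card_image)
    also have "\<dots> \<le> card C" using sub unfolding C_def by (intro card_mono finite_bounded_nats)
    finally have FC: "card (F ` S) \<le> card C" .
    have finE: "finite E" and cE: "real (card E) \<le> real M ^ 2 * L"
      using card_norm_collisions[OF \<open>M > 0\<close>] unfolding E_def F_def L_eq by auto
    have "{(a, b). a \<in> S \<and> b \<in> S \<and> F a = F b} \<subseteq> E"
      using S(3,4) unfolding E_def by fastforce
    then have "card {(a, b). a \<in> S \<and> b \<in> S \<and> F a = F b} \<le> card E" using finE by (intro card_mono)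
    then have cc: "real (card {(a, b). a \<in> S \<and> b \<in> S \<and> F a = F b}) \<le> real M ^ 2 * L" using cE by linarith
    have "(real N ^ 2 / 2)\<^sup>2 \<le> (real (card S))\<^sup>2"
      using elim(1) unfolding cS I_def by (intro power_mono) auto
    also have "\<dots> \<le> real (card (F ` S)) * real (card {(a, b). a \<in> S \<and> b \<in> S \<and> F a = F b})"
      by (rule card_image_Cauchy_Schwarz) fact
    also have "\<dots> \<le> real (card C) * (real M ^ 2 * L)"
      using FC cc by (intro mult_mono) auto
    finally have main: "real N ^ 4 / 4 \<le> real (card C) * (4 * real p ^ 2 * real N ^ 2 * L)"
      by (simp add: M_def power_divide power_mult_distrib flip: power_mult)
    have "1 \<le> 4 * real M" using \<open>M > 0\<close> by linarith
    then have "L > 0" unfolding L_eq by (intro add_pos_nonneg) auto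
    have "real N ^ 2 / (16 * real p ^ 2 * L) = (real N ^ 4 / 4) / (4 * real p ^ 2 * real N ^ 2 * L)"
      using elim(2) p0 \<open>L > 0\<close> by (simp add: field_simps power2_eq_square power4_eq_xxxx)
    also have "\<dots> \<le> real (card C)"
      using main elim(2) p0 \<open>L > 0\<close> by (subst pos_divide_le_eq) auto
    finally show ?case unfolding C_def L_def .
  qed
qed

text \<open>Passes from the sequence of bounds c N^4 to real X by taking N as the floor of (X /
  c)^(1/4).\<close>

lemma count_bigomega_nonzero:
  fixes p :: nat and r :: int
  assumes p: "prime p" "odd p" and r: "[r \<noteq> 0] (mod int p)"
  shows "(\<lambda>X::real. real (card {n::nat. 1 \<le> n \<and> real n \<le> X \<and>
             p_integral_cong p (hurwitz_class_number (- int n)) (of_int r)}))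
         \<in> \<Omega>[at_top](\<lambda>X. sqrt X / ln X)"
proof -
  define c where "c = 1152 * real p ^ 4"
  define C where "C = (\<lambda>X. {n::nat. 1 \<le> n \<and> real n \<le> X \<and>
             p_integral_cong p (hurwitz_class_number (- int n)) (of_int r)})"
  define N where "N = (\<lambda>X. nat \<lfloor>sqrt (sqrt (X / c))\<rfloor>)"
  have p1: "real p \<ge> 1" using p(1) prime_ge_1_nat by simp
  have "real p * 1 \<le> real p * real p ^ 3" using p1 by (intro mult_left_mono one_le_power) auto
  then have pc: "8 * real p \<le> c" unfolding c_def by (simp add: eval_nat_numeral)
  \<comment> \<open>3 exceeds e, so that X \<ge> c yields ln X \<ge> 1.\<close>
  have c: "c \<ge> 3" using pc p1 by linarith
  have lim: "filterlim N sequentially at_top"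
    unfolding N_def
  proof (rule filterlim_compose[OF filterlim_nat_sequentially filterlim_compose[OF filterlim_floor_sequentially]])
    show "filterlim (\<lambda>X. sqrt (sqrt (X / c))) at_top at_top"
      using c by real_asymp
  qed
  have ev: "eventually (\<lambda>X. real (N X) ^ 2 / (16 * real p ^ 2 * (65 + 64 * ln (8 * real p * real (N X)))) \<le>
     real (card (C (1152 * real p ^ 4 * real (N X) ^ 4)))) at_top"
    using filterlim_iff[THEN iffD1, OF lim, rule_format, OF eventually_count_ge[OF p r]] unfolding C_def .
  \<comment> \<open>From 2 on, the floor is at least half of the number.\<close>
  have ev2: "eventually (\<lambda>X. sqrt (sqrt (X / c)) \<ge> 2) at_top"
    using c by real_asymp
  \<comment> \<open>12352 = 4 * 193 * 16: 4 from squaring N \<ge> y / 2, 193 from the bound for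
    \<open>L\<close>, and 16 from \<open>eventually_count_ge\<close>.\<close>
  define K where "K = 12352 * real p ^ 2 * sqrt c"
  have "K > 0" using p1 c by (simp add: K_def)
  have "eventually (\<lambda>X. norm (sqrt X / ln X) \<le> K * norm (real (card (C X)))) at_top"
    using ev ev2 eventually_gt_at_top[of 0]
  proof eventually_elim
    case (elim X)
    define y where "y = sqrt (sqrt (X / c))"
    have y: "y \<ge> 2" "y ^ 2 = sqrt (X / c)"
      using elim(2,3) c by (auto simp: y_def)
    have "y ^ 4 = (y ^ 2) ^ 2" by (simp flip: power_mult)
    also have "\<dots> = X / c" unfolding y(2) using elim(3) c by simp
    finally have y4: "c * y ^ 4 = X" using c by simp
    have Ny: "real (N X) \<le> y" "real (N X) > y - 1"
      using y(1) unfolding N_def y_def[symmetric] by linarith+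
    have N1: "real (N X) \<ge> 1" "real (N X) \<ge> y / 2" using Ny y(1) by auto
    have N4: "real (N X) ^ 4 \<ge> 1" using N1(1) by (rule one_le_power)
    have cN: "c * real (N X) ^ 4 \<le> X"
    proof -
      have "c * real (N X) ^ 4 \<le> c * y ^ 4" using Ny c by (intro mult_left_mono power_mono) auto
      then show ?thesis unfolding y4 .
    qed
    have "c * 1 \<le> c * real (N X) ^ 4" using N4 c by (intro mult_left_mono) auto
    then have cX: "c \<le> X" using cN by simp
    have "real (N X) * 1 \<le> real (N X) * real (N X) ^ 3" using N1(1) by (intro mult_left_mono one_le_power) auto
    also have "\<dots> = 1 * real (N X) ^ 4" by (simp add: eval_nat_numeral)
    also have "\<dots> \<le> c * real (N X) ^ 4" using c by (intro mult_right_mono) auto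
    finally have NX: "real (N X) \<le> X" using cN by simp
    have "8 * real p * real (N X) \<le> X * X"
      using pc cX NX by (intro mult_mono) auto
    then have "ln (8 * real p * real (N X)) \<le> ln (X * X)"
      using p1 N1(1) elim(3) by (subst ln_le_cancel_iff) auto
    then have l1: "ln (8 * real p * real (N X)) \<le> 2 * ln X" using elim(3) by (simp add: ln_mult)
    have "exp 1 \<le> X" using exp_le c cX by linarith
    then have l2: "ln X \<ge> 1" using elim(3) by (simp add: ln_ge_iff)
    define L where "L = 65 + 64 * ln (8 * real p * real (N X))"
    \<comment> \<open>193 = 65 + 64 * 2, using 1 \<le> ln X and 8pN \<le> X^2.\<close>
    have L: "L \<le> 193 * ln X" using l1 l2 by (simp add: L_def)
    have "8 * real p * real (N X) \<ge> 1 * 1" using p1 N1(1) by (intro mult_mono) auto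
    then have "L > 0" by (simp add: L_def add_pos_nonneg)
    have "sqrt X / sqrt c = y ^ 2" using y(2) by (simp add: real_sqrt_divide)
    also have "y ^ 2 \<le> (2 * real (N X)) ^ 2" using N1 y(1) by (intro power_mono) auto
    finally have "sqrt X / sqrt c \<le> 4 * real (N X) ^ 2" by (simp add: power_mult_distrib)
    then have sX: "sqrt X \<le> 4 * real (N X) ^ 2 * sqrt c" using c by (simp add: pos_divide_le_eq)
    have "sqrt X / ln X \<le> (4 * real (N X) ^ 2 * sqrt c) / (L / 193)"
      using sX L \<open>L > 0\<close> elim(3) c by (intro frac_le) auto
    also have "\<dots> = K * (real (N X) ^ 2 / (16 * real p ^ 2 * L))"
      using p1 \<open>L > 0\<close> by (simp add: K_def field_simps)
    also have "\<dots> \<le> K * real (card (C (c * real (N X) ^ 4)))"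
      using elim(1) \<open>K > 0\<close> unfolding L_def c_def by (intro mult_left_mono) auto
    also have "\<dots> \<le> K * real (card (C X))"
    proof -
      have "C (c * real (N X) ^ 4) \<subseteq> C X" using cN by (auto simp: C_def)
      then have "card (C (c * real (N X) ^ 4)) \<le> card (C X)"
        unfolding C_def by (intro card_mono finite_bounded_nats)
      then show ?thesis using \<open>K > 0\<close> by simp
    qed
    finally show ?case using l2 elim(3) by simp
  qed
  then have "(\<lambda>X. real (card (C X))) \<in> \<Omega>[at_top](\<lambda>X. sqrt X / ln X)"
    unfolding bigomega_iff_bigo by (rule bigoI)
  then show ?thesis unfolding C_def .
qed

text \<open>The floor of X / 4 many numbers 4i + 1 count, and X / 4 - 1 \<ge> X / 8 once X \<ge> 8;
  hence the constant 8.\<close>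

lemma count_bigomega_zero:
  fixes p :: nat and r :: int
  assumes p: "prime p" and r: "[r = 0] (mod int p)"
  shows "(\<lambda>X::real. real (card {n::nat. 1 \<le> n \<and> real n \<le> X \<and>
             p_integral_cong p (hurwitz_class_number (- int n)) (of_int r)}))
         \<in> \<Omega>[at_top](\<lambda>X. X)"
  unfolding bigomega_iff_bigo
proof (rule bigoI)
  show "eventually (\<lambda>X. norm X \<le> 8 * norm (real (card {n::nat. 1 \<le> n \<and> real n \<le> X \<and>
             p_integral_cong p (hurwitz_class_number (- int n)) (of_int r)}))) at_top"
    using eventually_ge_at_top[of 8]
  proof eventually_elim
    case (elim X)
    define C where "C = {n::nat. 1 \<le> n \<and> real n \<le> X \<and>
             p_integral_cong p (hurwitz_class_number (- int n)) (of_int r)}"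
    define k where "k = nat \<lfloor>X / 4\<rfloor>"
    have k: "real k \<le> X / 4" "real k > X / 4 - 1" using elim unfolding k_def by linarith+
    have "(\<lambda>i. 4 * i + 1) ` {..<k} \<subseteq> C"
    proof (rule image_subsetI)
      fix i assume "i \<in> {..<k}"
      then have "real i + 1 \<le> real k" by simp
      then have "real (4 * i + 1) \<le> X" using k(1) by simp
      moreover have "hurwitz_class_number (- int (4 * i + 1)) = of_int 0"
        by (subst hurwitz_class_number_eq_0) auto
      moreover have "p_integral_cong p (of_int 0) (of_int r)"
        using p_integral_cong_of_int[OF p] r cong_sym by blast
      ultimately show "4 * i + 1 \<in> C" unfolding C_def by simp
    qed
    then have "card ((\<lambda>i. 4 * i + 1) ` {..<k}) \<le> card C"
      unfolding C_def by (intro card_mono finite_bounded_nats)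
    moreover have "card ((\<lambda>i. 4 * i + 1) ` {..<k}) = k" by (subst card_image) (auto intro: inj_onI)
    ultimately have "real k \<le> real (card C)" by simp
    then show ?case using k elim unfolding C_def[symmetric] by simp
  qed
qed

theorem theorem3:
  fixes p :: nat and r :: int
  assumes "prime p" and "p \<ge> 5"
  shows "(\<lambda>X::real. real (card {n::nat. 1 \<le> n \<and> real n \<le> X \<and>
             p_integral_cong p (hurwitz_class_number (- int n)) (of_int r)}))
         \<in> \<Omega>[at_top](\<lambda>X. if [r \<noteq> 0] (mod int p) then sqrt X / ln X else X)"
proof (cases "[r = 0] (mod int p)")
  case True
  with count_bigomega_zero[OF assms(1) True] show ?thesis by simp
next
  case False
  have "odd p" using assms prime_odd_nat by simp
  with count_bigomega_nonzero[OF assms(1) this False] False show ?thesis by simp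
qed

end
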